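(* Let $d\ge 2$ and let $\mu$ be a positive Borel measure on $\mathbb{R}^d$ whose support $E$ is bounded and with $\mu(E)=1$. Assume there are $0<\alpha\le d$ and $c_0>0$ such that $\mu(B(x,r))\le c_0\,r^{\alpha}$ for every open ball $B(x,r)\subset\mathbb{R}^d$. Let $\Omega\subset\mathbb{R}^d$ be a bounded Borel set with $|\Omega|>0$, and assume there are constants $0<\beta\le 1$ and $\kappa_1>0$ such that for every $h\in\mathbb{R}^d$ with $|h|$ small enough $$|(h+\Omega)\triangle\Omega|\le \kappa_1|h|^{\beta}.$$ Assume moreover that there exist $\kappa_2>0$, $\kappa_3>0$, a unit vector $\overline{\Theta}$ and a decreasing sequence $t_n\to 0$ with $t_n\le\kappa_3 t_{n+1}$ for all $n$, such that for every $n$ $$\kappa_2\,t_n^{\beta}\le |(t_n\overline{\Theta}+\Omega)\triangle\Omega|.$$ Then there exist positive constants $a,b,c$ such that for every $N$ and every point distribution $\mathcal{P}_N=\{z_1,\dots,z_N\}\subset\mathbb{R}^d$, $$\left\{\int_a^b\int_{SO(d)}\int_{\mathbb{R}^d}\left|\mathcal{D}_N(x+\tau\sigma\Omega)\right|^2\,dx\,d\sigma\,d\tau\right\}^{1/2}\ge c\,N^{1/2-\beta/(2\alpha)}.$$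
   Context: $|F|$ denotes Lebesgue measure of $F\subseteq\mathbb{R}^d$ and $A\triangle B=(A\setminus B)\cup(B\setminus A)$. For a point set $\mathcal{P}_N=\{z_1,\dots,z_N\}$ and a Borel set $R$, the discrepancy is $\mathcal{D}_N(R)=\mathrm{card}(\mathcal{P}_N\cap R)-N\mu(R)$. $d\sigma$ is the normalized Haar measure on the rotation group $SO(d)$; $x+\tau\sigma\Omega=\{x+\tau\sigma(y):y\in\Omega\}$. *)

theory Defs
  imports "HOL-Probability.Probability"
begin

definition symdiff :: "'a set \<Rightarrow> 'a set \<Rightarrow> 'a set" where
  "symdiff A B = (A - B) \<union> (B - A)"

definition msupport :: "'a::metric_space measure \<Rightarrow> 'a set" where
  "msupport M = {x. \<forall>r>0. emeasure M (ball x r) > 0}"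

definition SO :: "(real^'n^'n) set" where
  "SO = {A. orthogonal_matrix A \<and> det A = 1}"

text \<open>Normalized Haar measure on SO(d): a left-invariant Borel probability measure on SO(d).
  (Such a measure exists and is unique.)\<close>
definition is_haar_SO :: "(real^'n^'n) measure \<Rightarrow> bool" where
  "is_haar_SO H \<longleftrightarrow> prob_space H \<and> sets H = sets (restrict_space borel SO) \<and>
     (\<forall>g\<in>SO. \<forall>A\<in>sets H. emeasure H ((\<lambda>s. g ** s) ` A) = emeasure H A)"

definition discrepancy :: "'a measure \<Rightarrow> 'a set \<Rightarrow> 'a set \<Rightarrow> real" where
  "discrepancy M P R = real (card (P \<inter> R)) - real (card P) * measure M R"

definition rot_dil_trans :: "real^'n \<Rightarrow> real \<Rightarrow> real^'n^'n \<Rightarrow> (real^'n) set \<Rightarrow> (real^'n) set" where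
  "rot_dil_trans x \<tau> \<sigma> \<Omega> = (\<lambda>y. x + \<tau> *\<^sub>R (\<sigma> *v y)) ` \<Omega>"

end

theory Submission
  imports Defs
begin

text \<open>By Fourier duality the averaged discrepancy is at least the integral of \<open>|\<nu>^(\<xi>)|\<^sup>2 m (\<xi>)\<close>, where
  \<open>\<nu> = \<Sum>\<delta>\<^sub>z - N \<mu>\<close> and \<open>m (\<xi>)\<close> is the average of \<open>|\<chi>^|\<^sup>2\<close>, \<open>\<chi>\<close> the indicator of \<open>\<Omega>\<close>, over a
  spherical shell of radius comparable to \<open>|\<xi>|\<close>. The conditions on \<open>(h + \<Omega>) \<triangle> \<Omega>\<close> place \<open>L\<^sup>2\<close> mass of order
  \<open>R\<^sup>-\<^sup>\<beta>\<close> of \<open>\<chi>^\<close> in the frequency annulus of radius \<open>R\<close>, so \<open>m (\<xi>)\<close> dominates \<open>r\<^sup>d\<^sup>+\<^sup>\<beta> exp (- r\<^sup>2 |\<xi>|\<^sup>2 / 2)\<close> up to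
  constants. For this Gaussian the integral is \<open>r\<^sup>\<beta>\<close> times the Gaussian energy of \<open>\<nu>\<close> at scale \<open>r\<close>; with
  \<open>r\<close> a small multiple of \<open>N\<^sup>-\<^sup>1\<^sup>/\<^sup>\<alpha>\<close> the ball condition makes the cross terms between points and \<open>\<mu>\<close> smaller
  than the diagonal contribution \<open>N\<close>. All frequency integrals carry a Gaussian weight, so Fubini's
  theorem suffices in place of Plancherel's theorem.\<close>

subsection \<open>Gaussian weights\<close>

text \<open>The transform of \<chi> may vanish at many frequencies, and the lower hypothesis speaks
  only of one direction \<Theta> and of the scales \<open>t n\<close>, so no pointwise lower bound
  for it is at hand. What can be bounded below is its mass in a full annulus of radius about 1 /
  \<open>t n\<close>; rotations make this mass radial and dilations smear it over the radii, which
  is why both averages occur. The ratio bound for consecutive \<open>t n\<close> keeps the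
  proportions of the annuli fixed, so one interval [a, b] of dilations serves all N. Frequencies
  below 1 are not reached by these annuli; there a small dilation makes the transform comparable to
  its value |\<Omega>| > 0 at the origin. Only a lower bound is wanted, and every dropped term has a
  favourable sign: the Gaussian weight is at most 1, the off-diagonal point interactions are
  positive because the transform of a Gaussian is positive, and the self-energy of \<mu> is
  nonnegative. The method needs \<beta> < 2, since the frequencies below A / \<open>t n\<close>
  contribute a multiple of A powr (2 - \<beta>), which has to be made small.\<close>

definition gauss_weight :: "real \<Rightarrow> 'a::euclidean_space \<Rightarrow> real" where
  "gauss_weight s x = exp (- (s * norm x)\<^sup>2 / 2)"

text \<open>The centred normal density with standard deviation s in every coordinate.
  \<open>gauss_weight s\<close> is its characteristic function, so s is a length here and an inverse
  frequency there.\<close>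

definition gauss_density :: "real \<Rightarrow> 'a::euclidean_space \<Rightarrow> real" where
  "gauss_density s x = gauss_weight (1 / s) x / (sqrt (2 * pi) * s) ^ DIM('a)"

lemma gauss_weight_measurable [measurable]: "gauss_weight s \<in> borel_measurable borel"
  unfolding gauss_weight_def by measurable

lemma gauss_density_measurable [measurable]: "gauss_density s \<in> borel_measurable borel"
  unfolding gauss_density_def by measurable

lemma gauss_weight_nonneg [simp]: "0 \<le> gauss_weight s x"
  by (simp add: gauss_weight_def)

lemma gauss_weight_le_1: "gauss_weight s x \<le> 1"
  by (simp add: gauss_weight_def)

lemma gauss_density_nonneg: "0 < s \<Longrightarrow> 0 \<le> gauss_density s x"
  by (simp add: gauss_density_def)

lemma iexp_gauss_real:
  fixes a s :: real
  assumes "0 < s"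
  shows "has_bochner_integral lborel (\<lambda>u. exp (- (s * u)\<^sup>2 / 2) *\<^sub>R iexp (u * a))
           (of_real (sqrt (2 * pi) / s * exp (- (a / s)\<^sup>2 / 2)))"
proof -
  have int: "integrable lborel (\<lambda>u. std_normal_density u *\<^sub>R iexp (a / s * u))"
    by (rule Bochner_Integration.integrable_bound[OF integrable_std_normal_moment[of 0]]) auto
  have "(CLINT u|std_normal_distribution. iexp (a / s * u)) = of_real (exp (- (a / s)\<^sup>2 / 2))"
    using fun_cong[OF char_std_normal_distribution, of "a / s"] unfolding char_def .
  then have "(\<integral>u. std_normal_density u *\<^sub>R iexp (a / s * u) \<partial>lborel) = of_real (exp (- (a / s)\<^sup>2 / 2))"
    by (subst (asm) integral_density) auto
  with int have "has_bochner_integral lborel (\<lambda>u. std_normal_density u *\<^sub>R iexp (a / s * u)) 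
      (of_real (exp (- (a / s)\<^sup>2 / 2)))"
    by (simp add: has_bochner_integral_iff)
  from has_bochner_integral_scaleR_right[OF this, of "sqrt (2 * pi)"]
  have "has_bochner_integral lborel (\<lambda>u. exp (- u\<^sup>2 / 2) *\<^sub>R iexp (a / s * u)) 
      (of_real (sqrt (2 * pi) * exp (- (a / s)\<^sup>2 / 2)))"
    by (simp add: std_normal_density_def scaleR_conv_of_real)
  then have "has_bochner_integral lborel (\<lambda>u. exp (- (0 + s * u)\<^sup>2 / 2) *\<^sub>R iexp (a / s * (0 + s * u)))
      (of_real (sqrt (2 * pi) * exp (- (a / s)\<^sup>2 / 2)) /\<^sub>R \<bar>s\<bar>)"
    by (subst (asm) lborel_has_bochner_integral_real_affine_iff[of s _ _ 0]) (use assms in auto)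
  with assms
  have "has_bochner_integral lborel (\<lambda>u. exp (- (s * u)\<^sup>2 / 2) *\<^sub>R iexp (a / s * (s * u))) 
      (of_real (sqrt (2 * pi) * exp (- (a / s)\<^sup>2 / 2)) /\<^sub>R s)"
    by simp
  then show ?thesis
    using assms by (simp add: scaleR_conv_of_real field_simps)
qed

lemma norm_sq_Basis: "(norm (x::'a::euclidean_space))\<^sup>2 = (\<Sum>b\<in>Basis. (x \<bullet> b)\<^sup>2)"
  unfolding power2_norm_eq_inner by (subst euclidean_inner) (simp add: power2_eq_square)

lemma gauss_weight_prod: "gauss_weight s (x::'a::euclidean_space) = (\<Prod>b\<in>Basis. exp (- (s * (x \<bullet> b))\<^sup>2 / 2))"
  by (simp add: gauss_weight_def exp_sum[symmetric] power_mult_distrib norm_sq_Basis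
    sum_distrib_left sum_negf sum_divide_distrib)

text \<open>Gaussian and character both factor over the coordinates, and \<open>lborel\<close> is
  the image of a product of one-dimensional Lebesgue measures, so the one-dimensional formula is
  multiplied over \<open>Basis\<close>.\<close>

lemma iexp_gauss:
  fixes x :: "'a::euclidean_space"
  assumes s: "0 < s"
  shows "has_bochner_integral lborel (\<lambda>\<xi>. gauss_weight s \<xi> *\<^sub>R iexp (\<xi> \<bullet> x))
           (of_real ((2 * pi) ^ DIM('a) * gauss_density s x))"
proof -
  interpret product_sigma_finite "\<lambda>_::'a. lborel :: real measure" ..
  let ?P = "\<Pi>\<^sub>M b\<in>(Basis::'a set). (lborel :: real measure)"
  let ?g = "\<lambda>b u. exp (- (s * u)\<^sup>2 / 2) *\<^sub>R iexp (u * (x \<bullet> b))"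
  have g: "has_bochner_integral lborel (?g b) (of_real (sqrt (2 * pi) / s * exp (- (x \<bullet> b / s)\<^sup>2 / 2)))" for b
    by (rule iexp_gauss_real[OF s])
  have int: "integrable ?P (\<lambda>f. \<Prod>b\<in>Basis. ?g b (f b))"
    by (rule product_integrable_prod) (use g in \<open>auto simp: has_bochner_integral_iff\<close>)
  have val: "(\<integral>f. (\<Prod>b\<in>Basis. ?g b (f b)) \<partial>?P) = 
     (\<Prod>b\<in>Basis. of_real (sqrt (2 * pi) / s * exp (- (x \<bullet> b / s)\<^sup>2 / 2)))"
    by (subst product_integral_prod) (use g in \<open>auto simp: has_bochner_integral_iff\<close>)
  have dens: "(\<Prod>b\<in>Basis. sqrt (2 * pi) / s * exp (- (x \<bullet> b / s)\<^sup>2 / 2)) = 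
      (2 * pi) ^ DIM('a) * gauss_density s x"
  proof -
    \<comment> \<open>This separates, in each coordinate, the factor 2 pi of Fourier inversion from
      the normalisation of the density.\<close>
    have "sqrt (2 * pi) / s = (2 * pi) / (sqrt (2 * pi) * s)"
      using s by (simp add: field_simps)
    then have "(sqrt (2 * pi) / s) ^ DIM('a) = (2 * pi) ^ DIM('a) / (sqrt (2 * pi) * s) ^ DIM('a)"
      by (simp only: power_divide)
    then show ?thesis 
      unfolding gauss_density_def gauss_weight_prod prod.distrib prod_constant by simp
  qed
  have eq: "(\<Prod>b\<in>Basis. ?g b (f b)) = gauss_weight s (\<Sum>b\<in>Basis. f b *\<^sub>R b) *\<^sub>R iexp ((\<Sum>b\<in>Basis. f b *\<^sub>R b) \<bullet> x)" for f
  proof -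
    have c: "(\<Sum>b\<in>Basis. f b *\<^sub>R b) \<bullet> b = f b" if "b \<in> Basis" for b
      using that by simp
    have "(\<Sum>b\<in>Basis. f b *\<^sub>R b) \<bullet> x = (\<Sum>b\<in>Basis. f b * (x \<bullet> b))"
      by (simp add: inner_sum_right inner_commute[of _ x])
    then have "iexp ((\<Sum>b\<in>Basis. f b *\<^sub>R b) \<bullet> x) = (\<Prod>b\<in>Basis. iexp (f b * (x \<bullet> b)))"
      by (simp add: exp_sum sum_distrib_left)
    moreover have "gauss_weight s (\<Sum>b\<in>Basis. f b *\<^sub>R b) = (\<Prod>b\<in>Basis. exp (- (s * f b)\<^sup>2 / 2))"
      unfolding gauss_weight_prod by (intro prod.cong refl) (simp only: c)
    ultimately show ?thesis
      by (simp only: prod.distrib scaleR_conv_of_real of_real_prod)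
  qed
  have "has_bochner_integral ?P (\<lambda>f. gauss_weight s (\<Sum>b\<in>Basis. f b *\<^sub>R b) *\<^sub>R iexp ((\<Sum>b\<in>Basis. f b *\<^sub>R b) \<bullet> x))
      (of_real ((2 * pi) ^ DIM('a) * gauss_density s x))"
    using int val unfolding dens[symmetric] eq by (simp add: has_bochner_integral_iff)
  then show ?thesis
    by (subst lborel_eq, subst has_bochner_integral_distr) (auto simp: gauss_weight_def)
qed

lemma gauss_cos_integral:
  fixes x :: "'a::euclidean_space"
  assumes s: "0 < s"
  shows "has_bochner_integral lborel (\<lambda>\<xi>. gauss_weight s \<xi> * cos (\<xi> \<bullet> x))
           ((2 * pi) ^ DIM('a) * gauss_density s x)"
  using has_bochner_integral_Re[OF iexp_gauss[OF s, of x]] by (simp add: Re_exp)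

lemma gauss_weight_integral:
  assumes s: "0 < s"
  shows "has_bochner_integral lborel (gauss_weight s :: 'a::euclidean_space \<Rightarrow> real)
           ((sqrt (2 * pi) / s) ^ DIM('a))"
proof -
  have "(2 * pi) ^ DIM('a) / (sqrt (2 * pi) * s) ^ DIM('a) = (sqrt (2 * pi) / s) ^ DIM('a)"
    unfolding power_divide[symmetric]
    by (rule arg_cong[where f = "\<lambda>u. u ^ DIM('a)"]) (use s in \<open>simp add: field_simps\<close>)
  then show ?thesis
    using gauss_cos_integral[OF s, of "0::'a"] by (simp add: gauss_density_def gauss_weight_def[of _ 0])
qed

lemma gauss_density_integral:
  assumes s: "0 < s"
  shows "has_bochner_integral lborel (gauss_density s :: 'a::euclidean_space \<Rightarrow> real) 1"
proof -
  have "has_bochner_integral lborel (\<lambda>x. gauss_weight (1 / s) (x::'a) / (sqrt (2 * pi) * s) ^ DIM('a))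
      ((sqrt (2 * pi) / (1 / s)) ^ DIM('a) / (sqrt (2 * pi) * s) ^ DIM('a))"
    using s by (intro has_bochner_integral_divide_zero gauss_weight_integral) auto
  then show ?thesis
    using s unfolding gauss_density_def by simp
qed

section \<open>Fourier transform, autocorrelation and Plancherel's formula with a Gaussian
  weight\<close>

definition fourier :: "('a::euclidean_space \<Rightarrow> real) \<Rightarrow> 'a \<Rightarrow> complex" where
  "fourier f \<xi> = (\<integral>x. f x *\<^sub>R iexp (\<xi> \<bullet> x) \<partial>lborel)"

text \<open>Its transform is the squared modulus of \<open>fourier f\<close>
  (\<open>norm_fourier_sq\<close>), so a square on the frequency side becomes a single integral to
  which Fubini's theorem applies.\<close>

definition autocorr :: "('a::euclidean_space \<Rightarrow> real) \<Rightarrow> 'a \<Rightarrow> real" where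
  "autocorr f u = (\<integral>x. f x * f (x + u) \<partial>lborel)"

lemma lborel_integral_translate:
  fixes g :: "'a::euclidean_space \<Rightarrow> 'b::{banach, second_countable_topology}"
  shows "(\<integral>u. g (c + u) \<partial>lborel) = (\<integral>u. g u \<partial>lborel)"
    and "integrable lborel (\<lambda>u. g (c + u)) \<longleftrightarrow> integrable lborel g"
proof -
  show "integrable lborel (\<lambda>u. g (c + u)) \<longleftrightarrow> integrable lborel g" for c
  proof
    assume "integrable lborel g"
    then show "integrable lborel (\<lambda>u. g (c + u))"
      using integrable_distr[of "(+) c" lborel borel g] by (simp add: lborel_distr_plus)
  next
    assume "integrable lborel (\<lambda>u. g (c + u))"
    then show "integrable lborel g"
      using integrable_distr[of "(+) (- c)" lborel borel "\<lambda>u. g (c + u)"] by (simp add: lborel_distr_plus)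
  qed note * = this
  show "(\<integral>u. g (c + u) \<partial>lborel) = (\<integral>u. g u \<partial>lborel)"
  proof (cases "integrable lborel g")
    case True
    then have "g \<in> borel_measurable borel" by auto
    then show ?thesis
      using integral_distr[of "(+) c" lborel borel g] by (simp add: lborel_distr_plus)
  next
    case False
    \<comment> \<open>If g is not integrable, neither is its translate, and both integrals take the
      default value 0.\<close>
    then show ?thesis using *[of c] by (simp add: not_integrable_integral_eq)
  qed
qed

lemma integrable_iexp_inner:
  fixes f :: "'a::euclidean_space \<Rightarrow> real"
  assumes "integrable lborel f"
  shows "integrable lborel (\<lambda>x. f x *\<^sub>R iexp (\<xi> \<bullet> x))"
  by (rule Bochner_Integration.integrable_bound[OF assms]) (use assms in auto)

lemma integrable_mult_bounded:
  fixes f g :: "'a \<Rightarrow> real"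
  assumes "integrable M f" "g \<in> borel_measurable M" "\<And>x. \<bar>g x\<bar> \<le> 1"
  shows "integrable M (\<lambda>x. f x * g x)"
proof (rule Bochner_Integration.integrable_bound[OF assms(1)])
  show "(\<lambda>x. f x * g x) \<in> borel_measurable M" using assms by auto
  show "AE x in M. norm (f x * g x) \<le> norm (f x)"
    using assms(3) by (auto simp: abs_mult mult_left_le)
qed

lemma fourier_cos_sin:
  assumes "integrable lborel f"
  shows "Re (fourier f \<xi>) = (\<integral>x. f x * cos (\<xi> \<bullet> x) \<partial>lborel)"
    and "Im (fourier f \<xi>) = (\<integral>x. f x * sin (\<xi> \<bullet> x) \<partial>lborel)"
  unfolding fourier_def
  by (simp_all add: integral_Re[OF integrable_iexp_inner[OF assms], symmetric]
     integral_Im[OF integrable_iexp_inner[OF assms], symmetric] Re_exp Im_exp)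

lemma fourier_measurable [measurable]:
  assumes [measurable]: "f \<in> borel_measurable borel"
  shows "fourier f \<in> borel_measurable borel"
  unfolding fourier_def by measurable

lemma integrable_lborel_prod:
  fixes f :: "'a::euclidean_space \<Rightarrow> real" and g :: "'b::euclidean_space \<Rightarrow> real"
  assumes f: "integrable lborel f" and g: "integrable lborel g"
    and [measurable]: "h \<in> borel_measurable (lborel \<Otimes>\<^sub>M lborel)"
    and bound: "\<And>x y. \<bar>h (x, y)\<bar> \<le> \<bar>f x\<bar> * \<bar>g y\<bar>"
  shows "integrable (lborel \<Otimes>\<^sub>M lborel) h"
proof (rule Bochner_Integration.integrable_bound)
  have [measurable]: "f \<in> borel_measurable borel" "g \<in> borel_measurable borel" 
    using f g by auto
  show "integrable (lborel \<Otimes>\<^sub>M lborel) (\<lambda>p. f (fst p) * g (snd p))"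
  proof (rule lborel_pair.Fubini_integrable)
    have "integrable lborel (\<lambda>x. \<bar>f x\<bar> * (\<integral>y. \<bar>g y\<bar> \<partial>lborel))"
      using f by (intro integrable_mult_left) auto
    then show "integrable lborel (\<lambda>x. \<integral>y. norm (f (fst (x, y)) * g (snd (x, y))) \<partial>lborel)"
      by (simp add: abs_mult)
  qed (use g in auto)
  show "AE p in lborel \<Otimes>\<^sub>M lborel. norm (h p) \<le> norm (f (fst p) * g (snd p))"
    using bound by (auto simp: abs_mult)
qed simp

lemma integrable_shift_prod:
  fixes f :: "'a::euclidean_space \<Rightarrow> real"
  assumes f: "integrable lborel f"
  shows "integrable (lborel \<Otimes>\<^sub>M lborel) (\<lambda>(x, u). f x * f (x + u))"
proof -
  have [measurable]: "f \<in> borel_measurable borel" using f by auto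
  show ?thesis
  proof (rule lborel_pair.Fubini_integrable)
    have "integrable lborel (\<lambda>x. \<bar>f x\<bar> * (\<integral>y. \<bar>f y\<bar> \<partial>lborel))"
      using f by (intro integrable_mult_left) auto
    then show "integrable lborel (\<lambda>x. \<integral>y. norm (case (x, y) of (x, u) \<Rightarrow> f x * f (x + u)) \<partial>lborel)"
      by (simp add: abs_mult lborel_integral_translate(1)[of "\<lambda>u. \<bar>f u\<bar>"])
    show "AE x in lborel. integrable lborel (\<lambda>y. case (x, y) of (x, u) \<Rightarrow> f x * f (x + u))"
      using f by (simp add: lborel_integral_translate(2))
  qed simp
qed

lemma integrable_autocorr:
  fixes f :: "'a::euclidean_space \<Rightarrow> real"
  assumes f: "integrable lborel f"
  shows "integrable lborel (autocorr f)"
proof -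
  show ?thesis
    using lborel_pair.integrable_snd[of "\<lambda>x u. f x * f (x + u)"] integrable_shift_prod[OF f] 
    by (simp add: autocorr_def[abs_def])
qed

text \<open>After the substitution y = x + u the cosine of \<xi> \<bullet> y - \<xi> \<bullet> x
  splits by the addition theorem, which leaves the squares of the cosine and the sine integral, that
  is, of the real and the imaginary part.\<close>

lemma norm_fourier_sq:
  fixes f :: "'a::euclidean_space \<Rightarrow> real"
  assumes f: "integrable lborel f"
  shows "(cmod (fourier f \<xi>))\<^sup>2 = (\<integral>u. autocorr f u * cos (\<xi> \<bullet> u) \<partial>lborel)"
proof -
  have [measurable]: "f \<in> borel_measurable borel" using f by auto
  let ?c = "\<integral>x. f x * cos (\<xi> \<bullet> x) \<partial>lborel" and ?s = "\<integral>x. f x * sin (\<xi> \<bullet> x) \<partial>lborel"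
  have int_c: "integrable lborel (\<lambda>x. f x * cos (\<xi> \<bullet> x))" and int_s: "integrable lborel (\<lambda>x. f x * sin (\<xi> \<bullet> x))"
    by (rule integrable_mult_bounded[OF f]; simp)+
  have "integrable (lborel \<Otimes>\<^sub>M lborel) (\<lambda>p. (case p of (x, u) \<Rightarrow> f x * f (x + u)) * cos (\<xi> \<bullet> snd p))"
    by (rule integrable_mult_bounded[OF integrable_shift_prod[OF f]]) auto
  then have int: "integrable (lborel \<Otimes>\<^sub>M lborel) (\<lambda>(x, u). f x * f (x + u) * cos (\<xi> \<bullet> u))"
    by (simp add: case_prod_beta')
  have inner: "(\<integral>u. f x * f (x + u) * cos (\<xi> \<bullet> u) \<partial>lborel) = f x * cos (\<xi> \<bullet> x) * ?c + f x * sin (\<xi> \<bullet> x) * ?s" for x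
  proof -
    have "(\<integral>u. f x * f (x + u) * cos (\<xi> \<bullet> u) \<partial>lborel) = (\<integral>u. f x * f (x + u) * cos (\<xi> \<bullet> (x + u) - \<xi> \<bullet> x) \<partial>lborel)"
      by (simp add: inner_add_right)
    also have "\<dots> = (\<integral>y. f x * f y * cos (\<xi> \<bullet> y - \<xi> \<bullet> x) \<partial>lborel)"
      by (rule lborel_integral_translate(1)[of "\<lambda>y. f x * f y * cos (\<xi> \<bullet> y - \<xi> \<bullet> x)"])
    also have "\<dots> = (\<integral>y. f x * cos (\<xi> \<bullet> x) * (f y * cos (\<xi> \<bullet> y)) + f x * sin (\<xi> \<bullet> x) * (f y * sin (\<xi> \<bullet> y)) \<partial>lborel)"
      by (simp add: cos_diff algebra_simps)
    also have "\<dots> = f x * cos (\<xi> \<bullet> x) * ?c + f x * sin (\<xi> \<bullet> x) * ?s"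
      using int_c int_s by simp
    finally show ?thesis .
  qed
  have "(\<integral>u. autocorr f u * cos (\<xi> \<bullet> u) \<partial>lborel) = (\<integral>u. (\<integral>x. f x * f (x + u) * cos (\<xi> \<bullet> u) \<partial>lborel) \<partial>lborel)"
    by (simp add: autocorr_def)
  also have "\<dots> = (\<integral>x. (\<integral>u. f x * f (x + u) * cos (\<xi> \<bullet> u) \<partial>lborel) \<partial>lborel)"
    by (rule lborel_pair.Fubini_integral[OF int])
  also have "\<dots> = ?c * ?c + ?s * ?s"
    using int_c int_s unfolding inner by simp
  also have "\<dots> = (cmod (fourier f \<xi>))\<^sup>2"
    unfolding cmod_power2 fourier_cos_sin[OF f] by (simp add: power2_eq_square)
  finally show ?thesis by simp
qed

text \<open>Polarisation, with translation invariance of the integral of the square of f. It trades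
  the autocorrelation for the modulus of continuity, which the hypotheses on \<Omega>
  control.\<close>

lemma autocorr_eq:
  fixes f :: "'a::euclidean_space \<Rightarrow> real"
  assumes f2: "integrable lborel (\<lambda>x. (f x)\<^sup>2)" and [measurable]: "f \<in> borel_measurable borel"
  shows "integrable lborel (\<lambda>x. (f x - f (x + u))\<^sup>2)"
    and "autocorr f u = (\<integral>x. (f x)\<^sup>2 \<partial>lborel) - (\<integral>x. (f x - f (x + u))\<^sup>2 \<partial>lborel) / 2"
proof -
  have f2u: "integrable lborel (\<lambda>x. (f (x + u))\<^sup>2)"
    using f2 lborel_integral_translate(2)[of "\<lambda>x. (f x)\<^sup>2" u] by (simp add: add.commute)
  have eq: "(\<integral>x. (f (x + u))\<^sup>2 \<partial>lborel) = (\<integral>x. (f x)\<^sup>2 \<partial>lborel)"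
    using lborel_integral_translate(1)[of "\<lambda>x. (f x)\<^sup>2" u] by (simp add: add.commute)
  have int: "integrable lborel (\<lambda>x. f x * f (x + u))"
  proof (rule Bochner_Integration.integrable_bound)
    show "integrable lborel (\<lambda>x. (f x)\<^sup>2 + (f (x + u))\<^sup>2)" using f2 f2u by simp
    have "\<bar>a * b\<bar> \<le> a\<^sup>2 + b\<^sup>2" for a b :: real
    proof -
      have "0 \<le> (a - b)\<^sup>2" "0 \<le> (a + b)\<^sup>2" "0 \<le> a\<^sup>2" "0 \<le> b\<^sup>2" by simp_all
      then show ?thesis unfolding power2_diff power2_sum by (auto simp: abs_le_iff)
    qed
    then show "AE x in lborel. norm (f x * f (x + u)) \<le> norm ((f x)\<^sup>2 + (f (x + u))\<^sup>2)" by simp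
  qed simp
  have sq: "(f x - f (x + u))\<^sup>2 = (f x)\<^sup>2 + (f (x + u))\<^sup>2 - 2 * (f x * f (x + u))" for x
    by (simp add: power2_diff)
  show "integrable lborel (\<lambda>x. (f x - f (x + u))\<^sup>2)"
    unfolding sq using f2 f2u int by simp
  have "(\<integral>x. (f x - f (x + u))\<^sup>2 \<partial>lborel) = 2 * (\<integral>x. (f x)\<^sup>2 \<partial>lborel) - 2 * autocorr f u"
    unfolding sq using f2 f2u int by (simp add: eq autocorr_def)
  then show "autocorr f u = (\<integral>x. (f x)\<^sup>2 \<partial>lborel) - (\<integral>x. (f x - f (x + u))\<^sup>2 \<partial>lborel) / 2"
    by (simp add: diff_divide_distrib)
qed

text \<open>Fubini moves the Gaussian from the frequency side, where it forces convergence, to a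
  normal density acting on the autocorrelation. The defect against Plancherel's formula is explicit:
  half of the squared modulus of continuity, averaged at scale s.\<close>

lemma gauss_plancherel:
  fixes f :: "'a::euclidean_space \<Rightarrow> real"
  assumes f: "integrable lborel f" and f2: "integrable lborel (\<lambda>x. (f x)\<^sup>2)" and s: "0 < s"
  shows "has_bochner_integral lborel (\<lambda>\<xi>. gauss_weight s \<xi> * (cmod (fourier f \<xi>))\<^sup>2)
     ((2 * pi) ^ DIM('a) * ((\<integral>x. (f x)\<^sup>2 \<partial>lborel) -
        (\<integral>u. gauss_density s u * (\<integral>x. (f x - f (x + u))\<^sup>2 \<partial>lborel) \<partial>lborel) / 2))"
    and "integrable lborel (\<lambda>u. gauss_density s u * (\<integral>x. (f x - f (x + u))\<^sup>2 \<partial>lborel))"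
proof -
  have [measurable]: "f \<in> borel_measurable borel" using f by auto
  note ac = integrable_autocorr[OF f]
  have [measurable]: "autocorr f \<in> borel_measurable borel" using ac by auto
  have gw: "integrable lborel (gauss_weight s :: 'a \<Rightarrow> real)"
    using gauss_weight_integral[OF s, where 'a = 'a] by (simp add: has_bochner_integral_iff)
  have gd: "integrable lborel (gauss_density s :: 'a \<Rightarrow> real)" "(\<integral>u. gauss_density s (u::'a) \<partial>lborel) = 1"
    using gauss_density_integral[OF s, where 'a = 'a] by (simp_all add: has_bochner_integral_iff)
  have int: "integrable (lborel \<Otimes>\<^sub>M lborel) (\<lambda>(u, \<xi>). autocorr f u * (gauss_weight s \<xi> * cos (\<xi> \<bullet> u)))"
    by (rule integrable_lborel_prod[OF ac gw]) (auto simp: abs_mult mult_left_le intro!: mult_left_mono)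
  have outer: "(\<integral>u. autocorr f u * (gauss_weight s \<xi> * cos (\<xi> \<bullet> u)) \<partial>lborel) = gauss_weight s \<xi> * (cmod (fourier f \<xi>))\<^sup>2" for \<xi>
    unfolding norm_fourier_sq[OF f] 
    by (simp only: integral_mult_right_zero[symmetric] mult.left_commute)
  have inner: "(\<integral>\<xi>. autocorr f u * (gauss_weight s \<xi> * cos (\<xi> \<bullet> u)) \<partial>lborel) = 
     (2 * pi) ^ DIM('a) * (autocorr f u * gauss_density s u)" for u
    using has_bochner_integral_integral_eq[OF gauss_cos_integral[OF s, of u]] by simp
  have ac2: "autocorr f u * gauss_density s u = gauss_density s u * (\<integral>x. (f x)\<^sup>2 \<partial>lborel) - 
    gauss_density s u * (\<integral>x. (f x - f (x + u))\<^sup>2 \<partial>lborel) / 2" for u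
    by (subst autocorr_eq(2)[OF f2]) (simp_all add: algebra_simps)
  have "integrable lborel (\<lambda>u. (2 * pi) ^ DIM('a) * (autocorr f u * gauss_density s u))"
    using lborel_pair.integrable_fst[OF int] by (simp only: inner)
  then have i1: "integrable lborel (\<lambda>u. autocorr f u * gauss_density s u)"
    using integrable_mult_right[of "1 / (2 * pi) ^ DIM('a)" lborel "\<lambda>u. (2 * pi) ^ DIM('a) * (autocorr f u * gauss_density s u)"]
    by simp
  have "integrable lborel (\<lambda>u. 2 * (gauss_density s u * (\<integral>x. (f x)\<^sup>2 \<partial>lborel) - autocorr f u * gauss_density s u))"
    using gd i1 by simp
  then show i2: "integrable lborel (\<lambda>u. gauss_density s u * (\<integral>x. (f x - f (x + u))\<^sup>2 \<partial>lborel))"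
    unfolding ac2 by simp
  have "(\<integral>\<xi>. gauss_weight s \<xi> * (cmod (fourier f \<xi>))\<^sup>2 \<partial>lborel) = (2 * pi) ^ DIM('a) * (\<integral>u. autocorr f u * gauss_density s u \<partial>lborel)"
    using lborel_pair.Fubini_integral[OF int] unfolding outer inner by simp
  also have "\<dots> = (2 * pi) ^ DIM('a) * ((\<integral>x. (f x)\<^sup>2 \<partial>lborel) -
        (\<integral>u. gauss_density s u * (\<integral>x. (f x - f (x + u))\<^sup>2 \<partial>lborel) \<partial>lborel) / 2)"
    unfolding ac2 using gd i2 by simp
  finally show "has_bochner_integral lborel (\<lambda>\<xi>. gauss_weight s \<xi> * (cmod (fourier f \<xi>))\<^sup>2)
     ((2 * pi) ^ DIM('a) * ((\<integral>x. (f x)\<^sup>2 \<partial>lborel) -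
        (\<integral>u. gauss_density s u * (\<integral>x. (f x - f (x + u))\<^sup>2 \<partial>lborel) \<partial>lborel) / 2))"
    using lborel_pair.integrable_snd[OF int] by (simp add: has_bochner_integral_iff outer)
qed

subsection \<open>Frequency annuli\<close>

text \<open>The squared L2 modulus of continuity for a single shift; for an indicator it is the
  measure of a symmetric difference (\<open>sq_modulus_indicator\<close>).\<close>

definition sq_modulus :: "('a::euclidean_space \<Rightarrow> real) \<Rightarrow> 'a \<Rightarrow> real" where
  "sq_modulus f u = (\<integral>x. (f x - f (x + u))\<^sup>2 \<partial>lborel)"

lemma sq_modulus_nonneg: "0 \<le> sq_modulus f u"
  by (simp add: sq_modulus_def)

text \<open>The exponent 1/4 is half of the 1/2 in the Gaussian, so the product with a normal
  density is again a multiple of a normal density, only a wider one; see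
  \<open>gauss_density_exp\<close>.\<close>

lemma powr_le_exp:
  fixes v :: real
  assumes "0 < \<beta>" "\<beta> \<le> 2" "0 \<le> v"
  shows "v powr \<beta> \<le> 4 * exp (v\<^sup>2 / 4)"
proof -
  have "v powr \<beta> \<le> 1 + v\<^sup>2"
  proof (cases "v \<le> 1")
    case True
    then have "v powr \<beta> \<le> 1" using assms by (simp add: powr_le1)
    then show ?thesis by (smt (verit) zero_le_power2)
  next
    case False
    then have "v powr \<beta> \<le> v powr 2" using assms by (intro powr_mono) auto
    then show ?thesis using False by simp
  qed
  also have "\<dots> \<le> 4 * (1 + v\<^sup>2 / 4)" by simp
  also have "\<dots> \<le> 4 * exp (v\<^sup>2 / 4)" using exp_ge_add_one_self by (rule mult_left_mono) simp
  finally show ?thesis .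
qed

lemma gauss_density_exp:
  fixes u :: "'a::euclidean_space"
  assumes s: "0 < s"
  shows "gauss_density s u * exp ((norm u / s)\<^sup>2 / 4) = sqrt 2 ^ DIM('a) * gauss_density (sqrt 2 * s) u"
proof -
  have "gauss_weight (1 / s) u * exp ((norm u / s)\<^sup>2 / 4) = gauss_weight (1 / (sqrt 2 * s)) u"
    unfolding gauss_weight_def exp_add[symmetric]
    by (rule arg_cong[where f = exp]) (use s in \<open>simp add: field_simps\<close>)
  moreover have "(sqrt (2 * pi) * (sqrt 2 * s)) ^ DIM('a) = sqrt 2 ^ DIM('a) * (sqrt (2 * pi) * s) ^ DIM('a)"
    by (simp add: power_mult_distrib mult.left_commute)
  ultimately show ?thesis
    using s by (simp add: gauss_density_def)
qed

lemma gauss_moment: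
  fixes f :: "'a::euclidean_space \<Rightarrow> real"
  assumes f: "integrable lborel f" and f2: "integrable lborel (\<lambda>x. (f x)\<^sup>2)" and s: "0 < s"
    and \<beta>: "0 < \<beta>" "\<beta> \<le> 2" and K: "0 \<le> K" and hoelder: "\<And>u. sq_modulus f u \<le> K * norm u powr \<beta>"
  shows "(\<integral>u. gauss_density s u * sq_modulus f u \<partial>lborel) \<le> 4 * sqrt 2 ^ DIM('a) * K * s powr \<beta>"
proof -
  have gd: "integrable lborel (gauss_density (sqrt 2 * s) :: 'a \<Rightarrow> real)" 
      "(\<integral>u. gauss_density (sqrt 2 * s) (u::'a) \<partial>lborel) = 1"
    using gauss_density_integral[of "sqrt 2 * s", where 'a = 'a] s by (simp_all add: has_bochner_integral_iff)
  have "(\<integral>u. gauss_density s u * sq_modulus f u \<partial>lborel) \<le> 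
      (\<integral>u. (4 * sqrt 2 ^ DIM('a) * K * s powr \<beta>) * gauss_density (sqrt 2 * s) (u::'a) \<partial>lborel)"
  proof (rule integral_mono)
    show "integrable lborel (\<lambda>u. gauss_density s u * sq_modulus f u)"
      using gauss_plancherel(2)[OF f f2 s] by (simp add: sq_modulus_def)
    show "integrable lborel (\<lambda>u. (4 * sqrt 2 ^ DIM('a) * K * s powr \<beta>) * gauss_density (sqrt 2 * s) (u::'a))"
      using gd by simp
    fix u :: 'a
    have "norm u powr \<beta> = s powr \<beta> * (norm u / s) powr \<beta>"
      using s by (simp add: powr_divide)
    also have "\<dots> \<le> s powr \<beta> * (4 * exp ((norm u / s)\<^sup>2 / 4))"
      using s by (intro mult_left_mono powr_le_exp \<beta>) auto
    finally have "sq_modulus f u \<le> K * (s powr \<beta> * (4 * exp ((norm u / s)\<^sup>2 / 4)))"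
      using hoelder[of u] K by (meson mult_left_mono order_trans)
    then have "gauss_density s u * sq_modulus f u \<le> gauss_density s u * (K * (s powr \<beta> * (4 * exp ((norm u / s)\<^sup>2 / 4))))"
      using gauss_density_nonneg[OF s] by (rule mult_left_mono)
    also have "\<dots> = 4 * K * s powr \<beta> * (gauss_density s u * exp ((norm u / s)\<^sup>2 / 4))"
      by simp
    also have "\<dots> = 4 * sqrt 2 ^ DIM('a) * K * s powr \<beta> * gauss_density (sqrt 2 * s) u"
      unfolding gauss_density_exp[OF s] by simp
    finally show "gauss_density s u * sq_modulus f u \<le> 4 * sqrt 2 ^ DIM('a) * K * s powr \<beta> * gauss_density (sqrt 2 * s) u" .
  qed
  also have "\<dots> = 4 * sqrt 2 ^ DIM('a) * K * s powr \<beta>"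
    using gd by simp
  finally show ?thesis .
qed

text \<open>The exponents of the two Gaussians differ by 3 \<rho>^2 |\<xi>|^2 / 8, and exp y - 1
  \<ge> y. In this form the second moment can be read off \<open>gauss_plancherel\<close>: the main
  term, the integral of the square of f, cancels in the difference and only the small defects
  survive.\<close>

lemma norm_sq_gauss_weight_le:
  fixes \<xi> :: "'a::euclidean_space"
  assumes "0 < \<rho>"
  shows "(norm \<xi>)\<^sup>2 * gauss_weight \<rho> \<xi> \<le> 8 / (3 * \<rho>\<^sup>2) * (gauss_weight (\<rho> / 2) \<xi> - gauss_weight \<rho> \<xi>)"
proof -
  let ?y = "3 * \<rho>\<^sup>2 / 8 * (norm \<xi>)\<^sup>2"
  have "gauss_weight (\<rho> / 2) \<xi> = gauss_weight \<rho> \<xi> * exp ?y"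
    unfolding gauss_weight_def exp_add[symmetric]
    by (rule arg_cong[where f = exp]) (simp add: field_simps)
  then have "gauss_weight (\<rho> / 2) \<xi> - gauss_weight \<rho> \<xi> = gauss_weight \<rho> \<xi> * (exp ?y - 1)"
    by (simp add: algebra_simps)
  also have "\<dots> \<ge> gauss_weight \<rho> \<xi> * ?y"
  proof (rule mult_left_mono)
    show "?y \<le> exp ?y - 1" using exp_ge_add_one_self[of ?y] by linarith
  qed simp
  finally have "8 / (3 * \<rho>\<^sup>2) * (gauss_weight \<rho> \<xi> * ?y) \<le> 8 / (3 * \<rho>\<^sup>2) * (gauss_weight (\<rho> / 2) \<xi> - gauss_weight \<rho> \<xi>)"
    by (rule mult_left_mono) simp
  then show ?thesis using assms by (simp add: field_simps)
qed

lemma fourier_second_moment: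
  fixes f :: "'a::euclidean_space \<Rightarrow> real"
  assumes f: "integrable lborel f" and f2: "integrable lborel (\<lambda>x. (f x)\<^sup>2)" and \<rho>: "0 < \<rho>"
    and \<beta>: "0 < \<beta>" "\<beta> \<le> 2" and K: "0 \<le> K" and hoelder: "\<And>u. sq_modulus f u \<le> K * norm u powr \<beta>"
  shows "integrable lborel (\<lambda>\<xi>. (norm \<xi>)\<^sup>2 * gauss_weight \<rho> \<xi> * (cmod (fourier f \<xi>))\<^sup>2)"
    and "(\<integral>\<xi>. (norm \<xi>)\<^sup>2 * gauss_weight \<rho> \<xi> * (cmod (fourier f \<xi>))\<^sup>2 \<partial>lborel)
      \<le> (2 * pi) ^ DIM('a) * (16 / 3) * sqrt 2 ^ DIM('a) * K * \<rho> powr (\<beta> - 2)"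
proof -
  have [measurable]: "f \<in> borel_measurable borel" using f by auto
  let ?E = "\<lambda>s. \<integral>u. gauss_density s u * sq_modulus f u \<partial>lborel"
  have pl: "has_bochner_integral lborel (\<lambda>\<xi>. gauss_weight s \<xi> * (cmod (fourier f \<xi>))\<^sup>2)
     ((2 * pi) ^ DIM('a) * ((\<integral>x. (f x)\<^sup>2 \<partial>lborel) - ?E s / 2))" if "0 < s" for s
    using gauss_plancherel(1)[OF f f2 that] by (simp add: sq_modulus_def)
  have E_nonneg: "0 \<le> ?E s" if "0 < s" for s
    using gauss_density_nonneg[OF that] by (intro Bochner_Integration.integral_nonneg) (auto intro!: mult_nonneg_nonneg sq_modulus_nonneg)
  let ?R = "\<lambda>\<xi>. 8 / (3 * \<rho>\<^sup>2) * (gauss_weight (\<rho> / 2) \<xi> * (cmod (fourier f \<xi>))\<^sup>2 - gauss_weight \<rho> \<xi> * (cmod (fourier f \<xi>))\<^sup>2)"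
  have hR: "has_bochner_integral lborel ?R (8 / (3 * \<rho>\<^sup>2) * ((2 * pi) ^ DIM('a) * ((\<integral>x. (f x)\<^sup>2 \<partial>lborel) - ?E (\<rho>/2) / 2) - 
     (2 * pi) ^ DIM('a) * ((\<integral>x. (f x)\<^sup>2 \<partial>lborel) - ?E \<rho> / 2)))"
    using \<rho> by (intro has_bochner_integral_mult_right has_bochner_integral_diff pl) auto
  have le: "(norm \<xi>)\<^sup>2 * gauss_weight \<rho> \<xi> * (cmod (fourier f \<xi>))\<^sup>2 \<le> ?R \<xi>" for \<xi>
    using mult_right_mono[OF norm_sq_gauss_weight_le[OF \<rho>, of \<xi>], of "(cmod (fourier f \<xi>))\<^sup>2"]
    by (simp only: left_diff_distrib mult.assoc) simp
  show int: "integrable lborel (\<lambda>\<xi>. (norm \<xi>)\<^sup>2 * gauss_weight \<rho> \<xi> * (cmod (fourier f \<xi>))\<^sup>2)"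
  proof (rule Bochner_Integration.integrable_bound)
    show "integrable lborel ?R" using hR by (simp only: has_bochner_integral_iff)
    show "AE \<xi> in lborel. norm ((norm \<xi>)\<^sup>2 * gauss_weight \<rho> \<xi> * (cmod (fourier f \<xi>))\<^sup>2) \<le> norm (?R \<xi>)"
    proof (rule AE_I2)
      fix \<xi> :: 'a
      have "norm ((norm \<xi>)\<^sup>2 * gauss_weight \<rho> \<xi> * (cmod (fourier f \<xi>))\<^sup>2) = (norm \<xi>)\<^sup>2 * gauss_weight \<rho> \<xi> * (cmod (fourier f \<xi>))\<^sup>2"
        by simp
      also have "\<dots> \<le> norm (?R \<xi>)" using le[of \<xi>] unfolding real_norm_def by linarith
      finally show "norm ((norm \<xi>)\<^sup>2 * gauss_weight \<rho> \<xi> * (cmod (fourier f \<xi>))\<^sup>2) \<le> norm (?R \<xi>)" .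
    qed
  qed simp
  have "(\<integral>\<xi>. (norm \<xi>)\<^sup>2 * gauss_weight \<rho> \<xi> * (cmod (fourier f \<xi>))\<^sup>2 \<partial>lborel) \<le> integral\<^sup>L lborel ?R"
    using hR int le by (intro integral_mono) (simp_all only: has_bochner_integral_iff)
  also have "\<dots> = 8 / (3 * \<rho>\<^sup>2) * ((2 * pi) ^ DIM('a) * ((?E \<rho> - ?E (\<rho>/2)) / 2))"
    unfolding has_bochner_integral_integral_eq[OF hR] right_diff_distrib[symmetric]
    by (simp add: diff_divide_distrib)
  \<comment> \<open>The defect at scale \<rho>/2 is nonnegative and enters with a minus sign, so it
    is dropped.\<close>
  also have "\<dots> \<le> 8 / (3 * \<rho>\<^sup>2) * ((2 * pi) ^ DIM('a) * (4 * sqrt 2 ^ DIM('a) * K * \<rho> powr \<beta> / 2))"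
    using gauss_moment[OF f f2 \<rho> \<beta> K hoelder] E_nonneg[of "\<rho>/2"] \<rho> by (intro mult_left_mono divide_right_mono) auto
  also have "\<dots> = (2 * pi) ^ DIM('a) * (16 / 3) * sqrt 2 ^ DIM('a) * K * (\<rho> powr \<beta> / \<rho> powr 2)"
    using \<rho> by simp
  finally show "(\<integral>\<xi>. (norm \<xi>)\<^sup>2 * gauss_weight \<rho> \<xi> * (cmod (fourier f \<xi>))\<^sup>2 \<partial>lborel)
      \<le> (2 * pi) ^ DIM('a) * (16 / 3) * sqrt 2 ^ DIM('a) * K * \<rho> powr (\<beta> - 2)"
    by (simp add: powr_diff)
qed

section \<open>Mass of the transform in an annulus\<close>

lemma fourier_difference:
  fixes f :: "'a::euclidean_space \<Rightarrow> real"
  assumes f: "integrable lborel f"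
  shows "(cmod (fourier (\<lambda>x. f x - f (x + h)) \<xi>))\<^sup>2 = (2 - 2 * cos (\<xi> \<bullet> h)) * (cmod (fourier f \<xi>))\<^sup>2"
proof -
  have fh: "integrable lborel (\<lambda>x. f (x + h))"
    using f lborel_integral_translate(2)[of f h] by (simp add: add.commute)
  have "(\<integral>x. f (x + h) *\<^sub>R iexp (\<xi> \<bullet> x) \<partial>lborel) = (\<integral>x. iexp (- (\<xi> \<bullet> h)) * (f (h + x) *\<^sub>R iexp (\<xi> \<bullet> (h + x))) \<partial>lborel)"
    by (rule Bochner_Integration.integral_cong) 
       (auto simp: scaleR_conv_of_real inner_add_right exp_add[symmetric] algebra_simps simp flip: mult.assoc)
  also have "\<dots> = iexp (- (\<xi> \<bullet> h)) * (\<integral>x. f (h + x) *\<^sub>R iexp (\<xi> \<bullet> (h + x)) \<partial>lborel)"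
    by (rule integral_mult_right_zero)
  also have "\<dots> = iexp (- (\<xi> \<bullet> h)) * fourier f \<xi>"
    using lborel_integral_translate(1)[of "\<lambda>x. f x *\<^sub>R iexp (\<xi> \<bullet> x)" h] by (simp only: fourier_def)
  finally have "fourier (\<lambda>x. f x - f (x + h)) \<xi> = (1 - iexp (- (\<xi> \<bullet> h))) * fourier f \<xi>"
    using integrable_iexp_inner[OF f, of \<xi>] integrable_iexp_inner[OF fh, of \<xi>]
    by (simp add: fourier_def scaleR_diff_left algebra_simps)
  moreover have "(cmod (1 - iexp (- (\<xi> \<bullet> h))))\<^sup>2 = 2 - 2 * cos (\<xi> \<bullet> h)"
    using sin_cos_squared_add[of "\<xi> \<bullet> h"] by (simp add: cmod_power2 Re_exp Im_exp power2_diff)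
  ultimately show ?thesis by (simp add: norm_mult power_mult_distrib)
qed

lemma sq_modulus_difference:
  fixes f :: "'a::euclidean_space \<Rightarrow> real"
  assumes f2: "integrable lborel (\<lambda>x. (f x)\<^sup>2)" and [measurable]: "f \<in> borel_measurable borel"
  shows "sq_modulus (\<lambda>x. f x - f (x + h)) u \<le> 4 * sq_modulus f u"
proof -
  let ?g = "\<lambda>x. (f x - f (x + u))\<^sup>2"
  have int: "integrable lborel ?g" using autocorr_eq(1)[OF f2] by simp
  have inth: "integrable lborel (\<lambda>x. ?g (h + x))" 
    using int lborel_integral_translate(2)[of ?g h] by simp
  have "sq_modulus (\<lambda>x. f x - f (x + h)) u \<le> (\<integral>x. 2 * ?g x + 2 * ?g (h + x) \<partial>lborel)"
    unfolding sq_modulus_def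
  proof (rule integral_mono')
    show "integrable lborel (\<lambda>x. 2 * ?g x + 2 * ?g (h + x))" using int inth by simp
    fix x
    have "(f x - f (x + h) - (f (x + u) - f (x + u + h)))\<^sup>2 = ((f x - f (x + u)) - (f (h + x) - f (h + x + u)))\<^sup>2"
      by (simp add: algebra_simps)
    also have "\<dots> \<le> 2 * ?g x + 2 * ?g (h + x)"
      using zero_le_power2[of "(f x - f (x + u)) + (f (h + x) - f (h + x + u))"]
      unfolding power2_diff[of "f x - f (x + u)"] power2_sum[of "f x - f (x + u)"] by linarith
    finally show "(f x - f (x + h) - (f (x + u) - f (x + u + h)))\<^sup>2 \<le> 2 * ?g x + 2 * ?g (h + x)" .
  qed simp
  also have "\<dots> = 2 * integral\<^sup>L lborel ?g + 2 * (\<integral>x. ?g (h + x) \<partial>lborel)"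
    using int inth by simp
  also have "\<dots> = 4 * sq_modulus f u"
    using lborel_integral_translate(1)[of ?g h] by (simp add: sq_modulus_def)
  finally show ?thesis .
qed

text \<open>Here \<open>gauss_plancherel\<close> is applied to the difference of f and its translate
  by h, whose squared norm is \<open>sq_modulus f h\<close>. The defect inherits the Hoelder bound
  of f and is at most a multiple of s powr \<beta>, hence small against norm h powr \<beta> once s
  is a small multiple of norm h.\<close>

lemma fourier_difference_lower:
  fixes f :: "'a::euclidean_space \<Rightarrow> real"
  assumes f: "integrable lborel f" and f2: "integrable lborel (\<lambda>x. (f x)\<^sup>2)" and s: "0 < s"
    and \<beta>: "0 < \<beta>" "\<beta> \<le> 2" and K: "0 \<le> K" and hoelder: "\<And>u. sq_modulus f u \<le> K * norm u powr \<beta>"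
  shows "integrable lborel (\<lambda>\<xi>. gauss_weight s \<xi> * ((2 - 2 * cos (\<xi> \<bullet> h)) * (cmod (fourier f \<xi>))\<^sup>2))"
    and "(2 * pi) ^ DIM('a) * (sq_modulus f h - 8 * sqrt 2 ^ DIM('a) * K * s powr \<beta>) \<le>
     (\<integral>\<xi>. gauss_weight s \<xi> * ((2 - 2 * cos (\<xi> \<bullet> h)) * (cmod (fourier f \<xi>))\<^sup>2) \<partial>lborel)"
proof -
  have [measurable]: "f \<in> borel_measurable borel" using f by auto
  let ?g = "\<lambda>x. f x - f (x + h)"
  have fh: "integrable lborel (\<lambda>x. f (x + h))"
    using f lborel_integral_translate(2)[of f h] by (simp add: add.commute)
  have g: "integrable lborel ?g" using f fh by simp
  have g2: "integrable lborel (\<lambda>x. (?g x)\<^sup>2)" using autocorr_eq(1)[OF f2] by simp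
  have pl: "has_bochner_integral lborel (\<lambda>\<xi>. gauss_weight s \<xi> * ((2 - 2 * cos (\<xi> \<bullet> h)) * (cmod (fourier f \<xi>))\<^sup>2))
     ((2 * pi) ^ DIM('a) * (sq_modulus f h - (\<integral>u. gauss_density s u * sq_modulus ?g u \<partial>lborel) / 2))"
    using gauss_plancherel(1)[OF g g2 s] unfolding fourier_difference[OF f] by (simp add: sq_modulus_def)
  then show "integrable lborel (\<lambda>\<xi>. gauss_weight s \<xi> * ((2 - 2 * cos (\<xi> \<bullet> h)) * (cmod (fourier f \<xi>))\<^sup>2))"
    by (simp only: has_bochner_integral_iff)
  have "sq_modulus ?g u \<le> (4 * K) * norm u powr \<beta>" for u
    using sq_modulus_difference[OF f2, of h u] hoelder[of u] by simp
  from gauss_moment[OF g g2 s \<beta> _ this] K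
  have "(\<integral>u. gauss_density s u * sq_modulus ?g u \<partial>lborel) / 2 \<le> 8 * sqrt 2 ^ DIM('a) * K * s powr \<beta>" 
    by simp
  then show "(2 * pi) ^ DIM('a) * (sq_modulus f h - 8 * sqrt 2 ^ DIM('a) * K * s powr \<beta>) \<le>
     (\<integral>\<xi>. gauss_weight s \<xi> * ((2 - 2 * cos (\<xi> \<bullet> h)) * (cmod (fourier f \<xi>))\<^sup>2) \<partial>lborel)"
    unfolding has_bochner_integral_integral_eq[OF pl] by (intro mult_left_mono) auto
qed

lemma two_minus_two_cos_le: "2 - 2 * cos \<theta> \<le> (\<theta>::real)\<^sup>2"
proof -
  have "(sin (\<theta> / 2))\<^sup>2 \<le> (\<theta> / 2)\<^sup>2"
    using abs_sin_x_le_abs_x[of "\<theta> / 2"] by (simp only: abs_le_square_iff)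
  moreover have "cos \<theta> = 1 - 2 * (sin (\<theta> / 2))\<^sup>2"
    using cos_double_sin[of "\<theta> / 2"] by simp
  ultimately show ?thesis by (simp add: power_divide)
qed

text \<open>The difference symbol \<open>2 - 2 cos (\<xi> \<bullet> h)\<close> is small at low frequencies, the Gaussian weight
  cuts off the high ones, and only an annulus at scale \<open>1 / t\<close> remains.\<close>

lemma annulus_pointwise:
  fixes \<xi> h :: "'a::euclidean_space"
  assumes t: "0 < t" "norm h = t" and A: "0 < A" and B: "0 < B"
  shows "gauss_weight s \<xi> * (2 - 2 * cos (\<xi> \<bullet> h)) \<le>
     4 * indicator {\<xi>. A \<le> t * norm \<xi> \<and> t * norm \<xi> \<le> B} \<xi> +
     t\<^sup>2 * exp (1/2) * ((norm \<xi>)\<^sup>2 * gauss_weight (t / A) \<xi>) + 4 * t\<^sup>2 / B\<^sup>2 * ((norm \<xi>)\<^sup>2 * gauss_weight s \<xi>)"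
  (is "?L \<le> ?a + ?l + ?h")
proof -
  have nn: "0 \<le> ?a" "0 \<le> ?l" "0 \<le> ?h" by (auto simp: indicator_def)
  have c: "0 \<le> 2 - 2 * cos (\<xi> \<bullet> h)" "2 - 2 * cos (\<xi> \<bullet> h) \<le> 4"
    using cos_le_one[of "\<xi> \<bullet> h"] cos_ge_minus_one[of "\<xi> \<bullet> h"] by linarith+
  consider "A \<le> t * norm \<xi> \<and> t * norm \<xi> \<le> B" | "t * norm \<xi> < A" | "B < t * norm \<xi>" by linarith
  then show ?thesis
  proof cases
    case 1
    have "?L \<le> 1 * 4" by (intro mult_mono c gauss_weight_le_1) auto
    moreover have "?a = 4" using 1 by simp
    ultimately show ?thesis using nn by linarith
  next
    \<comment> \<open>At low frequencies the Gaussian of scale t / A is at least exp (- 1/2). The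
      factor exp (1/2) compensates this and turns the error into a weighted second moment.\<close>
    case 2
    have "(t * norm \<xi> / A)\<^sup>2 \<le> 1"
      using 2 t A by (intro power_le_one) auto
    then have "1 \<le> exp (1/2) * gauss_weight (t / A) \<xi>"
      unfolding gauss_weight_def exp_add[symmetric] by simp
    have "(\<xi> \<bullet> h)\<^sup>2 \<le> (norm \<xi> * norm h)\<^sup>2"
      using Cauchy_Schwarz_ineq2[of \<xi> h] by (simp add: abs_le_square_iff[symmetric])
    then have "2 - 2 * cos (\<xi> \<bullet> h) \<le> t\<^sup>2 * (norm \<xi>)\<^sup>2"
      using two_minus_two_cos_le[of "\<xi> \<bullet> h"] t(2) by (simp add: power_mult_distrib mult.commute)
    then have "?L \<le> 1 * (t\<^sup>2 * (norm \<xi>)\<^sup>2)"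
      using c by (intro mult_mono gauss_weight_le_1) auto
    also have "\<dots> \<le> (exp (1/2) * gauss_weight (t / A) \<xi>) * (t\<^sup>2 * (norm \<xi>)\<^sup>2)"
      using \<open>1 \<le> exp (1/2) * gauss_weight (t / A) \<xi>\<close> by (rule mult_right_mono) simp
    also have "\<dots> = ?l" by simp
    finally show ?thesis using nn by linarith
  next
    \<comment> \<open>As in Chebyshev's inequality, the factor t^2 |\<xi>|^2 / B^2 exceeds 1 at high
      frequencies.\<close>
    case 3
    have "B\<^sup>2 \<le> (t * norm \<xi>)\<^sup>2" using 3 B by (intro power_mono) auto
    then have "1 \<le> t\<^sup>2 * (norm \<xi>)\<^sup>2 / B\<^sup>2" using B by (simp add: power_mult_distrib)
    then have "4 \<le> 4 * (t\<^sup>2 * (norm \<xi>)\<^sup>2 / B\<^sup>2)" by linarith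
    with c have "2 - 2 * cos (\<xi> \<bullet> h) \<le> 4 * (t\<^sup>2 * (norm \<xi>)\<^sup>2 / B\<^sup>2)" by linarith
    then have "?L \<le> gauss_weight s \<xi> * (4 * (t\<^sup>2 * (norm \<xi>)\<^sup>2 / B\<^sup>2))"
      by (rule mult_left_mono) simp
    also have "\<dots> = ?h" by simp
    finally show ?thesis using nn by linarith
  qed
qed

lemma integrable_fourier_annulus:
  fixes f :: "'a::euclidean_space \<Rightarrow> real"
  assumes f: "integrable lborel f" and f2: "integrable lborel (\<lambda>x. (f x)\<^sup>2)" and t: "0 < t"
  shows "integrable lborel (\<lambda>\<xi>. indicator {\<xi>. A \<le> t * norm \<xi> \<and> t * norm \<xi> \<le> B} \<xi> * (cmod (fourier f \<xi>))\<^sup>2)"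
proof (rule Bochner_Integration.integrable_bound)
  have [measurable]: "f \<in> borel_measurable borel" using f by auto
  show "integrable lborel (\<lambda>\<xi>. exp (B\<^sup>2 / 2) * (gauss_weight t \<xi> * (cmod (fourier f \<xi>))\<^sup>2))"
    using gauss_plancherel(1)[OF f f2 t] unfolding has_bochner_integral_iff by (intro integrable_mult_right) auto
  have "indicator {\<xi>. A \<le> t * norm \<xi> \<and> t * norm \<xi> \<le> B} \<xi> \<le> exp (B\<^sup>2 / 2) * gauss_weight t \<xi>" for \<xi> :: 'a
  proof (cases "t * norm \<xi> \<le> B")
    case True
    then have "(t * norm \<xi>)\<^sup>2 \<le> B\<^sup>2" using t by (intro power_mono) auto
    then show ?thesis unfolding gauss_weight_def exp_add[symmetric] by (simp add: indicator_def)
  qed simp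
  from mult_right_mono[OF this]
  show "AE \<xi> in lborel. norm (indicator {\<xi>. A \<le> t * norm \<xi> \<and> t * norm \<xi> \<le> B} \<xi> * (cmod (fourier f \<xi>))\<^sup>2)
     \<le> norm (exp (B\<^sup>2 / 2) * (gauss_weight t \<xi> * (cmod (fourier f \<xi>))\<^sup>2))"
    by (intro AE_I2) (auto simp: abs_mult mult.assoc)
  show "(\<lambda>\<xi>. indicator {\<xi>. A \<le> t * norm \<xi> \<and> t * norm \<xi> \<le> B} \<xi> * (cmod (fourier f \<xi>))\<^sup>2) \<in> borel_measurable lborel"
    by measurable
qed

lemma fourier_annulus_lower:
  fixes f :: "'a::euclidean_space \<Rightarrow> real"
  assumes f: "integrable lborel f" and f2: "integrable lborel (\<lambda>x. (f x)\<^sup>2)"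
    and \<beta>: "0 < \<beta>" "\<beta> < 2" and K: "0 < K" and hoelder: "\<And>u. sq_modulus f u \<le> K * norm u powr \<beta>"
    and \<kappa>: "0 < \<kappa>"
  obtains A B c where "0 < A" "0 < B" "0 < c"
    "\<And>t h. 0 < t \<Longrightarrow> norm h = t \<Longrightarrow> \<kappa> * t powr \<beta> \<le> sq_modulus f h \<Longrightarrow>
       c * t powr \<beta> \<le> (\<integral>\<xi>. indicator {\<xi>. A \<le> t * norm \<xi> \<and> t * norm \<xi> \<le> B} \<xi> * (cmod (fourier f \<xi>))\<^sup>2 \<partial>lborel)"
proof -
  define M where "M = (2 * pi) ^ DIM('a)"
  define L where "L = 8 * sqrt 2 ^ DIM('a) * K"
  define C where "C = M * (16 / 3) * sqrt 2 ^ DIM('a) * K"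
  have pos: "0 < M" "0 < L" "0 < C" using K by (auto simp: M_def L_def C_def)
  \<comment> \<open>The budget: of the main term M \<kappa> t powr \<beta>, one half goes to the
    Gaussian cutoff at scale \<delta> t, an eighth to the low and an eighth to the high frequencies.
    The numbers \<delta>, A and B solve these three equations; for A this rests on 2 - \<beta> > 0.
    A quarter remains, and the factor 4 in front of the indicator turns it into M \<kappa> /
    16.\<close>
  define \<delta> where "\<delta> = (\<kappa> / (2 * L)) powr (1 / \<beta>)"
  define A where "A = (M * \<kappa> / (8 * exp (1/2) * C)) powr (1 / (2 - \<beta>))"
  define B where "B = sqrt (32 * C * \<delta> powr (\<beta> - 2) / (M * \<kappa>))"
  have d: "0 < \<delta>" "0 < A" using pos \<kappa> by (simp_all add: \<delta>_def A_def)
  then have B: "0 < B" using pos \<kappa> by (simp add: B_def)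
  have \<delta>_eq: "\<delta> powr \<beta> = \<kappa> / (2 * L)" using \<beta> pos \<kappa> by (simp add: \<delta>_def powr_powr)
  have A_eq: "A powr (2 - \<beta>) = M * \<kappa> / (8 * exp (1/2) * C)" using \<beta> pos \<kappa> by (simp add: A_def powr_powr)
  have B_eq: "B\<^sup>2 = 32 * C * \<delta> powr (\<beta> - 2) / (M * \<kappa>)" using pos \<kappa> d by (simp add: B_def)
  show thesis
  proof (rule that[OF d(2) B])
    show "0 < M * \<kappa> / 16" using pos \<kappa> by simp
    fix t :: real and h :: 'a
    assume t: "0 < t" and h: "norm h = t" and low: "\<kappa> * t powr \<beta> \<le> sq_modulus f h"
    let ?F = "\<lambda>\<xi>. (cmod (fourier f \<xi>))\<^sup>2"
    let ?I = "indicator {\<xi>::'a. A \<le> t * norm \<xi> \<and> t * norm \<xi> \<le> B} :: 'a \<Rightarrow> real"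
    define s where "s = \<delta> * t"
    have s: "0 < s" and tA: "0 < t / A" using d t by (simp_all add: s_def)
    note sm = fourier_second_moment[OF f f2 _ \<beta>(1) less_imp_le[OF \<beta>(2)] less_imp_le[OF K] hoelder]
    note dl = fourier_difference_lower[OF f f2 s \<beta>(1) less_imp_le[OF \<beta>(2)] less_imp_le[OF K] hoelder]
    have ia: "integrable lborel (\<lambda>\<xi>. ?I \<xi> * ?F \<xi>)" by (rule integrable_fourier_annulus[OF f f2 t])
    have "M * (\<kappa> / 2 * t powr \<beta>) = M * (\<kappa> * t powr \<beta> - L * s powr \<beta>)"
      using d t pos by (simp add: s_def powr_mult \<delta>_eq field_simps)
    also have "\<dots> \<le> M * (sq_modulus f h - L * s powr \<beta>)"
      using low pos by (intro mult_left_mono) auto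
    also have "\<dots> \<le> (\<integral>\<xi>. gauss_weight s \<xi> * ((2 - 2 * cos (\<xi> \<bullet> h)) * ?F \<xi>) \<partial>lborel)"
      using dl(2)[of h] by (simp add: M_def L_def)
    also have "\<dots> \<le> (\<integral>\<xi>. 4 * (?I \<xi> * ?F \<xi>) + t\<^sup>2 * exp (1/2) * ((norm \<xi>)\<^sup>2 * gauss_weight (t / A) \<xi> * ?F \<xi>) + 
        4 * t\<^sup>2 / B\<^sup>2 * ((norm \<xi>)\<^sup>2 * gauss_weight s \<xi> * ?F \<xi>) \<partial>lborel)"
    proof (rule integral_mono)
      show "integrable lborel (\<lambda>\<xi>. gauss_weight s \<xi> * ((2 - 2 * cos (\<xi> \<bullet> h)) * ?F \<xi>))" by (rule dl(1))
      show "integrable lborel (\<lambda>\<xi>. 4 * (?I \<xi> * ?F \<xi>) + t\<^sup>2 * exp (1/2) * ((norm \<xi>)\<^sup>2 * gauss_weight (t / A) \<xi> * ?F \<xi>) + 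
        4 * t\<^sup>2 / B\<^sup>2 * ((norm \<xi>)\<^sup>2 * gauss_weight s \<xi> * ?F \<xi>))"
        by (intro Bochner_Integration.integrable_add integrable_mult_right ia sm(1) tA s)
      fix \<xi> :: 'a
      show "gauss_weight s \<xi> * ((2 - 2 * cos (\<xi> \<bullet> h)) * ?F \<xi>) \<le> 4 * (?I \<xi> * ?F \<xi>) + 
        t\<^sup>2 * exp (1/2) * ((norm \<xi>)\<^sup>2 * gauss_weight (t / A) \<xi> * ?F \<xi>) + 4 * t\<^sup>2 / B\<^sup>2 * ((norm \<xi>)\<^sup>2 * gauss_weight s \<xi> * ?F \<xi>)"
        using mult_right_mono[OF annulus_pointwise[OF t h d(2) B, of s \<xi>], of "?F \<xi>"]
        by (simp add: distrib_right mult.assoc)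
    qed
    also have "\<dots> = 4 * (\<integral>\<xi>. ?I \<xi> * ?F \<xi> \<partial>lborel) + t\<^sup>2 * exp (1/2) * (\<integral>\<xi>. (norm \<xi>)\<^sup>2 * gauss_weight (t / A) \<xi> * ?F \<xi> \<partial>lborel) + 
        4 * t\<^sup>2 / B\<^sup>2 * (\<integral>\<xi>. (norm \<xi>)\<^sup>2 * gauss_weight s \<xi> * ?F \<xi> \<partial>lborel)"
      using ia sm(1)[OF tA] sm(1)[OF s] by simp
    also have "\<dots> \<le> 4 * (\<integral>\<xi>. ?I \<xi> * ?F \<xi> \<partial>lborel) + t\<^sup>2 * exp (1/2) * (C * (t / A) powr (\<beta> - 2)) + 
        4 * t\<^sup>2 / B\<^sup>2 * (C * s powr (\<beta> - 2))"
      using sm(2)[OF tA] sm(2)[OF s] by (intro add_mono mult_left_mono order_refl) (auto simp: C_def M_def)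
    also have "t\<^sup>2 * exp (1/2) * (C * (t / A) powr (\<beta> - 2)) = M * \<kappa> / 8 * t powr \<beta>"
    proof -
      have "(t / A) powr (\<beta> - 2) = t powr \<beta> / t\<^sup>2 * A powr (2 - \<beta>)"
        using t d by (simp add: powr_divide powr_diff)
      then show ?thesis using t pos by (simp add: A_eq)
    qed
    also have "4 * t\<^sup>2 / B\<^sup>2 * (C * s powr (\<beta> - 2)) = M * \<kappa> / 8 * t powr \<beta>"
    proof -
      have "s powr (\<beta> - 2) = \<delta> powr (\<beta> - 2) * (t powr \<beta> / t\<^sup>2)"
        using t d by (simp add: s_def powr_mult powr_diff)
      then show ?thesis using t pos d \<kappa> by (simp add: B_eq)
    qed
    finally show "M * \<kappa> / 16 * t powr \<beta> \<le> (\<integral>\<xi>. ?I \<xi> * ?F \<xi> \<partial>lborel)"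
      by (simp add: field_simps)
  qed
qed

subsection \<open>Rotations and spherical averages\<close>

declare transpose_matrix_vector [simp del]

lemma matrix_vector_mult_measurable [measurable]:
  "(*v) (A :: real^'n^'m) \<in> borel \<rightarrow>\<^sub>M borel"
  by (intro borel_measurable_continuous_onI linear_continuous_on) (simp add: linear_linear)

lemma nn_integral_lborel_translate:
  fixes f :: "'a::euclidean_space \<Rightarrow> ennreal"
  assumes [measurable]: "f \<in> borel_measurable borel"
  shows "(\<integral>\<^sup>+x. f (c + x) \<partial>lborel) = (\<integral>\<^sup>+x. f x \<partial>lborel)"
  by (subst (2) lborel_distr_plus[of c, symmetric]) (simp add: nn_integral_distr)

text \<open>As in the uniqueness proof for Haar measure, \<open>\<integral> f (A x) dx\<close> and \<open>\<integral> f (x) dx\<close> are both compared with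
  \<open>\<integral>\<integral> f (A x + y) g (y) dx dy\<close>, where \<open>g\<close> is a Gaussian density and hence invariant under \<open>A\<close>.\<close>

lemma nn_integral_orthogonal:
  fixes A :: "real^'n^'n" and f :: "real^'n \<Rightarrow> ennreal"
  assumes A: "orthogonal_matrix A" and [measurable]: "f \<in> borel_measurable borel"
  shows "(\<integral>\<^sup>+x. f (A *v x) \<partial>lborel) = (\<integral>\<^sup>+x. f x \<partial>lborel)"
proof -
  have inv: "A *v (transpose A *v x) = x" for x
    using A by (simp add: matrix_vector_mul_assoc orthogonal_matrix_def)
  define g where "g x = ennreal (gauss_density 1 x)" for x :: "real^'n"
  have [measurable]: "g \<in> borel_measurable borel" unfolding g_def by measurable
  have g1: "(\<integral>\<^sup>+x. g x \<partial>lborel) = 1"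
    using gauss_density_integral[of 1, where 'a = "real^'n"] gauss_density_nonneg[of 1, where 'a = "real^'n"]
    unfolding g_def by (subst nn_integral_eq_integral) (auto simp: has_bochner_integral_iff)
  have g_norm: "g x = g y" if "norm x = norm y" for x y
    using that by (simp add: g_def gauss_density_def gauss_weight_def)
  have "(\<integral>\<^sup>+x. f (A *v x) \<partial>lborel) = (\<integral>\<^sup>+y. (\<integral>\<^sup>+x. f (A *v x) \<partial>lborel) * g y \<partial>lborel)"
    by (simp add: nn_integral_cmult g1)
  also have "\<dots> = (\<integral>\<^sup>+y. (\<integral>\<^sup>+x. f (A *v x + y) * g y \<partial>lborel) \<partial>lborel)"
  proof (rule nn_integral_cong)
    fix y
    have "(\<integral>\<^sup>+x. f (A *v x) \<partial>lborel) = (\<integral>\<^sup>+x. f (A *v (transpose A *v y + x)) \<partial>lborel)"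
      by (rule nn_integral_lborel_translate[symmetric]) simp
    also have "\<dots> = (\<integral>\<^sup>+x. f (A *v x + y) \<partial>lborel)"
      by (simp add: matrix_vector_right_distrib inv add.commute)
    finally show "(\<integral>\<^sup>+x. f (A *v x) \<partial>lborel) * g y = (\<integral>\<^sup>+x. f (A *v x + y) * g y \<partial>lborel)"
      by (simp add: nn_integral_multc)
  qed
  also have "\<dots> = (\<integral>\<^sup>+x. (\<integral>\<^sup>+y. f (A *v x + y) * g y \<partial>lborel) \<partial>lborel)"
    by (rule lborel_pair.Fubini') measurable
  also have "\<dots> = (\<integral>\<^sup>+x. (\<integral>\<^sup>+y. f y * g (y - A *v x) \<partial>lborel) \<partial>lborel)"
  proof (rule nn_integral_cong)
    fix x
    show "(\<integral>\<^sup>+y. f (A *v x + y) * g y \<partial>lborel) = (\<integral>\<^sup>+y. f y * g (y - A *v x) \<partial>lborel)"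
      using nn_integral_lborel_translate[of "\<lambda>y. f y * g (y - A *v x)" "A *v x"] by simp
  qed
  also have "\<dots> = (\<integral>\<^sup>+y. (\<integral>\<^sup>+x. f y * g (y - A *v x) \<partial>lborel) \<partial>lborel)"
    by (rule lborel_pair.Fubini'[symmetric]) measurable
  also have "\<dots> = (\<integral>\<^sup>+y. f y \<partial>lborel)"
  proof (rule nn_integral_cong)
    fix y
    have "g (y - A *v x) = g (- (transpose A *v y) + x)" for x
    proof (rule g_norm)
      have "norm (y - A *v x) = norm (A *v (transpose A *v y - x))"
        by (simp add: matrix_vector_mult_diff_distrib inv)
      also have "\<dots> = norm (transpose A *v y - x)"
        using A by (intro orthogonal_transformation_norm) (simp add: orthogonal_transformation_matrix)
      finally show "norm (y - A *v x) = norm (- (transpose A *v y) + x)"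
        by (simp add: norm_minus_commute)
    qed
    then show "(\<integral>\<^sup>+x. f y * g (y - A *v x) \<partial>lborel) = f y"
      by (simp add: nn_integral_cmult nn_integral_lborel_translate[of g] g1 del: uminus_add_conv_diff)
  qed
  finally show ?thesis .
qed

lemma lborel_distr_orthogonal:
  fixes A :: "real^'n^'n"
  assumes A: "orthogonal_matrix A"
  shows "distr lborel borel ((*v) A) = lborel"
proof (rule measure_eqI)
  fix X assume "X \<in> sets (distr lborel borel ((*v) A))"
  then have [measurable]: "X \<in> sets borel" by simp
  have "emeasure (distr lborel borel ((*v) A)) X = (\<integral>\<^sup>+x. indicator X x \<partial>distr lborel borel ((*v) A))"
    by simp
  also have "\<dots> = (\<integral>\<^sup>+x. indicator X (A *v x) \<partial>lborel)"
    by (rule nn_integral_distr) auto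
  also have "\<dots> = emeasure lborel X"
    by (subst nn_integral_orthogonal[OF A]) auto
  finally show "emeasure (distr lborel borel ((*v) A)) X = emeasure lborel X" .
qed simp

lemma nn_integral_scaleR:
  fixes f :: "'a::euclidean_space \<Rightarrow> ennreal"
  assumes [measurable]: "f \<in> borel_measurable borel" and c: "0 < c"
  shows "(\<integral>\<^sup>+x. f x \<partial>lborel) = ennreal (c ^ DIM('a)) * (\<integral>\<^sup>+x. f (c *\<^sub>R x) \<partial>lborel)"
  by (subst lborel_affine[of c 0]) (use c in \<open>simp_all add: nn_integral_density nn_integral_distr nn_integral_cmult\<close>)

lemma continuous_on_matrix_mult:
  "continuous_on UNIV (\<lambda>s::real^'n^'n. g ** s)"
  unfolding matrix_matrix_mult_def by (intro continuous_intros)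

lemma continuous_on_transpose_mult:
  "continuous_on UNIV (\<lambda>p::(real^'n^'n) \<times> (real^'n). transpose (fst p) *v snd p)"
  unfolding matrix_vector_mult_def transpose_def by (simp add: continuous_intros)

lemma transpose_mult_measurable:
  "(\<lambda>p::(real^'n^'n) \<times> (real^'n). transpose (fst p) *v snd p) \<in> borel_measurable (borel \<Otimes>\<^sub>M borel)"
  using borel_measurable_continuous_onI[OF continuous_on_transpose_mult] by (simp add: borel_prod)

lemma SO_orthogonal: "A \<in> SO \<Longrightarrow> orthogonal_matrix A"
  by (simp add: SO_def)

lemma SO_transpose: "A \<in> SO \<Longrightarrow> transpose A \<in> SO"
  by (simp add: SO_def orthogonal_matrix_transpose)

lemma SO_mult: "A \<in> SO \<Longrightarrow> B \<in> SO \<Longrightarrow> A ** B \<in> SO"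
  by (simp add: SO_def orthogonal_matrix_mul det_mul)

text \<open>Here d \<ge> 2 enters: in dimension 1 the group is trivial and cannot carry a to -
  a.\<close>

lemma SO_transitive:
  fixes a b :: "real^'n"
  assumes "2 \<le> CARD('n)" "norm a = norm b"
  obtains g where "g \<in> SO" "g *v a = b"
proof -
  obtain f where f: "orthogonal_transformation f" "det (matrix f) = 1" "f a = b"
    using rotation_exists[OF assms] .
  then have "matrix f *v a = b"
    by (simp add: orthogonal_transformation_linear matrix_works)
  moreover have "matrix f \<in> SO"
    using f by (simp add: SO_def orthogonal_transformation_matrix)
  ultimately show thesis using that by blast
qed

section \<open>Averages over the rotation group\<close>

locale haar =
  fixes H :: "(real^'n^'n) measure"
  assumes haar: "is_haar_SO H"
begin

sublocale prob_space H
  using haar by (simp add: is_haar_SO_def)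

lemma sets_H: "sets H = sets (restrict_space borel SO)"
  using haar by (simp add: is_haar_SO_def)

lemma space_H: "space H = SO"
  using sets_eq_imp_space_eq[OF sets_H] by (simp add: space_restrict_space)

lemma measurable_H_iff: "measurable H N = measurable (restrict_space borel SO) N"
  by (rule measurable_cong_sets[OF sets_H refl])

lemma measurable_H: "f \<in> borel \<rightarrow>\<^sub>M N \<Longrightarrow> f \<in> H \<rightarrow>\<^sub>M N"
  unfolding measurable_H_iff by (rule measurable_restrict_space1)

lemma measurable_H_id [measurable]: "(\<lambda>s. s) \<in> H \<rightarrow>\<^sub>M borel"
  by (rule measurable_H) simp

lemma distr_left_mult:
  assumes g: "g \<in> SO"
  shows "distr H H (\<lambda>s. g ** s) = H"
proof (rule measure_eqI)
  have gg: "g ** (transpose g ** s) = s" "transpose g ** (g ** s) = s" for s :: "real^'n^'n"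
    using SO_orthogonal[OF g] by (simp_all add: matrix_mul_assoc orthogonal_matrix_def)
  have gm: "(\<lambda>s. g ** s) \<in> H \<rightarrow>\<^sub>M H"
  proof -
    have "(\<lambda>s. g ** s) \<in> restrict_space borel SO \<rightarrow>\<^sub>M restrict_space borel SO"
      using SO_mult[OF g] borel_measurable_continuous_onI[OF continuous_on_matrix_mult]
      by (intro measurable_restrict_space3) auto
    then show ?thesis
      by (subst measurable_cong_sets[OF sets_H sets_H])
  qed
  fix A assume "A \<in> sets (distr H H (\<lambda>s. g ** s))"
  then have A: "A \<in> sets H" by simp
  then have AS: "A \<subseteq> SO" using sets.sets_into_space space_H by blast
  \<comment> \<open>\<open>is_haar_SO\<close> states invariance for images, \<open>distr\<close> is
    about preimages; the preimage under multiplication by g is the image under multiplication by its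
    inverse \<open>transpose g\<close>.\<close>
  have pre: "(\<lambda>s. g ** s) -` A \<inter> space H = (\<lambda>s. transpose g ** s) ` A"
  proof (intro equalityI subsetI)
    fix s assume "s \<in> (\<lambda>s. g ** s) -` A \<inter> space H"
    then show "s \<in> (\<lambda>s. transpose g ** s) ` A" 
      using gg(2)[of s] by (intro image_eqI[of _ _ "g ** s"]) auto
  next
    fix s assume "s \<in> (\<lambda>s. transpose g ** s) ` A"
    then show "s \<in> (\<lambda>s. g ** s) -` A \<inter> space H"
      using gg AS SO_mult[OF SO_transpose[OF g]] by (auto simp: space_H)
  qed
  have "emeasure (distr H H (\<lambda>s. g ** s)) A = emeasure H ((\<lambda>s. transpose g ** s) ` A)"
    using gm A by (simp add: emeasure_distr pre)
  also have "\<dots> = emeasure H A"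
    using haar SO_transpose[OF g] A by (simp add: is_haar_SO_def)
  finally show "emeasure (distr H H (\<lambda>s. g ** s)) A = emeasure H A" .
qed simp

text \<open>The transpose appears because the transform of a set rotated by \<sigma>, taken at
  \<xi>, is the transform of the set itself at \<open>transpose \<sigma> *v \<xi>\<close>; see
  \<open>fourier_rot_dil\<close>.\<close>

definition rot_avg :: "(real^'n \<Rightarrow> ennreal) \<Rightarrow> real^'n \<Rightarrow> ennreal" where
  "rot_avg F \<xi> = (\<integral>\<^sup>+\<sigma>. F (transpose \<sigma> *v \<xi>) \<partial>H)"

lemma transpose_mult_measurable_H [measurable (raw)]:
  assumes "f \<in> N \<rightarrow>\<^sub>M H" "g \<in> N \<rightarrow>\<^sub>M borel"
  shows "(\<lambda>x. transpose (f x) *v g x) \<in> borel_measurable N"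
proof -
  have "f \<in> N \<rightarrow>\<^sub>M borel"
    using measurable_comp[OF assms(1) measurable_H_id] by (simp add: comp_def)
  then have "(\<lambda>x. (f x, g x)) \<in> N \<rightarrow>\<^sub>M borel \<Otimes>\<^sub>M borel"
    using assms(2) by simp
  from measurable_comp[OF this transpose_mult_measurable] show ?thesis
    by (simp add: comp_def)
qed

lemma rot_avg_measurable [measurable]:
  assumes [measurable]: "F \<in> borel_measurable borel"
  shows "rot_avg F \<in> borel_measurable borel"
  unfolding rot_avg_def by measurable

text \<open>Transposition turns the left translate \<open>transpose g ** \<sigma>\<close> into
  \<open>transpose \<sigma> ** g\<close>, which acts on \<eta> first through g. So left invariance
  of \<open>H\<close> makes the average constant on the orbits of SO, and these are the
  spheres.\<close>

lemma rot_avg_radial: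
  assumes dim: "2 \<le> CARD('n)" and [measurable]: "F \<in> borel_measurable borel" and eq: "norm \<xi> = norm \<eta>"
  shows "rot_avg F \<xi> = rot_avg F \<eta>"
proof -
  obtain g where g: "g \<in> SO" "g *v \<eta> = \<xi>" using SO_transitive[OF dim eq[symmetric]] .
  have gm: "(\<lambda>s. transpose g ** s) \<in> H \<rightarrow>\<^sub>M H"
  proof -
    have "(\<lambda>s. transpose g ** s) \<in> restrict_space borel SO \<rightarrow>\<^sub>M restrict_space borel SO"
      using SO_mult[OF SO_transpose[OF g(1)]] borel_measurable_continuous_onI[OF continuous_on_matrix_mult]
      by (intro measurable_restrict_space3) auto
    then show ?thesis
      by (subst measurable_cong_sets[OF sets_H sets_H])
  qed
  have "rot_avg F \<eta> = (\<integral>\<^sup>+\<sigma>. F (transpose \<sigma> *v \<eta>) \<partial>distr H H (\<lambda>s. transpose g ** s))"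
    using distr_left_mult[OF SO_transpose[OF g(1)]] by (simp add: rot_avg_def)
  also have "\<dots> = (\<integral>\<^sup>+\<sigma>. F (transpose (transpose g ** \<sigma>) *v \<eta>) \<partial>H)"
    using gm by (subst nn_integral_distr) auto
  also have "\<dots> = rot_avg F \<xi>"
    unfolding rot_avg_def g(2)[symmetric] by (simp add: matrix_transpose_mul matrix_vector_mul_assoc)
  finally show ?thesis by simp
qed

lemma nn_integral_rot_avg:
  assumes [measurable]: "F \<in> borel_measurable borel"
  shows "(\<integral>\<^sup>+\<xi>. rot_avg F \<xi> \<partial>lborel) = (\<integral>\<^sup>+\<xi>. F \<xi> \<partial>lborel)"
proof -
  interpret P: pair_sigma_finite H lborel ..
  have "(\<integral>\<^sup>+\<xi>. rot_avg F \<xi> \<partial>lborel) = (\<integral>\<^sup>+\<sigma>. (\<integral>\<^sup>+\<xi>. F (transpose \<sigma> *v \<xi>) \<partial>lborel) \<partial>H)"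
    unfolding rot_avg_def by (rule P.Fubini') measurable
  also have "\<dots> = (\<integral>\<^sup>+\<sigma>. (\<integral>\<^sup>+\<xi>. F \<xi> \<partial>lborel) \<partial>H)"
    by (intro nn_integral_cong nn_integral_orthogonal SO_orthogonal SO_transpose) (auto simp: space_H)
  also have "\<dots> = (\<integral>\<^sup>+\<xi>. F \<xi> \<partial>lborel)"
    by (simp add: emeasure_space_1)
  finally show ?thesis .
qed

text \<open>Averaging over dilations in \<open>[1, 2]\<close> replaces integration in polar coordinates.\<close>

lemma annulus_le_ray:
  fixes F :: "real^'n \<Rightarrow> ennreal"
  assumes dim: "2 \<le> CARD('n)" and [measurable]: "F \<in> borel_measurable borel"
    and p: "0 < p" and R: "0 < R" and \<xi>0: "norm \<xi>0 = R"
    and supp: "\<And>\<xi>. \<not> (p * R \<le> norm \<xi> \<and> norm \<xi> \<le> q * R) \<Longrightarrow> F \<xi> = 0"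
  shows "(\<integral>\<^sup>+\<xi>. F \<xi> \<partial>lborel) \<le> ennreal (2 ^ CARD('n) * 2 / p) * emeasure lborel (cball (0::real^'n) (q * R)) *
     (\<integral>\<^sup>+\<tau>. indicator {p/2..2*q} \<tau> * rot_avg F (\<tau> *\<^sub>R \<xi>0) \<partial>lborel)"
proof -
  let ?G = "rot_avg F"
  let ?J = "\<integral>\<^sup>+\<tau>. indicator {p/2..2*q} \<tau> * ?G (\<tau> *\<^sub>R \<xi>0) \<partial>lborel"
  have G0: "?G \<xi> = 0" if "\<not> (p * R \<le> norm \<xi> \<and> norm \<xi> \<le> q * R)" for \<xi>
  proof -
    have "F (transpose \<sigma> *v \<xi>) = 0" if "\<sigma> \<in> space H" for \<sigma>
    proof (rule supp)
      have "orthogonal_transformation ((*v) (transpose \<sigma>))"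
        using that by (simp add: space_H SO_orthogonal SO_transpose orthogonal_transformation_matrix)
      then have "norm (transpose \<sigma> *v \<xi>) = norm \<xi>" by (rule orthogonal_transformation_norm)
      with \<open>\<not> _\<close> show "\<not> (p * R \<le> norm (transpose \<sigma> *v \<xi>) \<and> norm (transpose \<sigma> *v \<xi>) \<le> q * R)" by simp
    qed
    then have "?G \<xi> = (\<integral>\<^sup>+\<sigma>. 0 \<partial>H)"
      unfolding rot_avg_def by (intro nn_integral_cong)
    then show ?thesis by simp
  qed
  have inner: "(\<integral>\<^sup>+\<tau>. indicator {1..2} \<tau> * ?G (\<tau> *\<^sub>R \<xi>) \<partial>lborel) \<le> 
      indicator (cball 0 (q * R)) \<xi> * (ennreal (2 / p) * ?J)" for \<xi>
  proof (cases "p / 2 * R \<le> norm \<xi> \<and> norm \<xi> \<le> q * R")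
    case False
    \<comment> \<open>For \<xi> outside the enlarged shell no multiple of \<xi> by a factor from
      [1, 2] meets the annulus that supports F.\<close>
    have "indicator {1..2} \<tau> * ?G (\<tau> *\<^sub>R \<xi>) = 0" for \<tau> :: real
    proof (cases "\<tau> \<in> {1..2}")
      case True
      have "\<not> (p * R \<le> norm (\<tau> *\<^sub>R \<xi>) \<and> norm (\<tau> *\<^sub>R \<xi>) \<le> q * R)"
      proof
        assume *: "p * R \<le> norm (\<tau> *\<^sub>R \<xi>) \<and> norm (\<tau> *\<^sub>R \<xi>) \<le> q * R"
        have "1 * norm \<xi> \<le> norm (\<tau> *\<^sub>R \<xi>)" "norm (\<tau> *\<^sub>R \<xi>) \<le> 2 * norm \<xi>"
          using True mult_right_mono[of 1 \<tau> "norm \<xi>"] mult_right_mono[of \<tau> 2 "norm \<xi>"] by auto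
        with * False show False by auto
      qed
      then show ?thesis by (simp add: G0)
    qed simp
    then show ?thesis by (simp only: nn_integral_0_iff_AE) simp
  next
    case True
    \<comment> \<open>The average is radial, so the ray through \<xi> may be replaced by the ray
      through \<xi>0 with parameter v \<tau>. The substitution carries [1, 2] to [v, 2 v], which
      lies in [p/2, 2 q].\<close>
    define v where "v = norm \<xi> / R"
    have v: "p / 2 \<le> v" "v \<le> q" using True R by (auto simp: v_def field_simps)
    with p have v0: "0 < v" by linarith
    have Gv: "?G (\<tau> *\<^sub>R \<xi>) = ?G ((v * \<tau>) *\<^sub>R \<xi>0)" for \<tau>
      using R by (intro rot_avg_radial[OF dim]) (auto simp: \<xi>0 v_def abs_mult)
    have "ennreal v * (\<integral>\<^sup>+\<tau>. indicator {1..2} \<tau> * ?G (\<tau> *\<^sub>R \<xi>) \<partial>lborel) = 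
        ennreal v * (\<integral>\<^sup>+\<tau>. indicator {v..2 * v} (0 + v * \<tau>) * ?G ((0 + v * \<tau>) *\<^sub>R \<xi>0) \<partial>lborel)"
      using v v0 by (intro arg_cong2[where f="(*)"] refl nn_integral_cong) (auto simp: Gv indicator_def)
    also have "\<dots> = (\<integral>\<^sup>+\<tau>. indicator {v..2 * v} \<tau> * ?G (\<tau> *\<^sub>R \<xi>0) \<partial>lborel)"
      using v v0 by (subst (2) nn_integral_real_affine[of _ v 0]) auto
    also have "\<dots> \<le> ?J"
      using v v0 by (intro nn_integral_mono mult_right_mono) (auto simp: indicator_def)
    finally have *: "ennreal v * (\<integral>\<^sup>+\<tau>. indicator {1..2} \<tau> * ?G (\<tau> *\<^sub>R \<xi>) \<partial>lborel) \<le> ?J" .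
    have "(\<integral>\<^sup>+\<tau>. indicator {1..2} \<tau> * ?G (\<tau> *\<^sub>R \<xi>) \<partial>lborel) = 
        ennreal (1 / v) * (ennreal v * (\<integral>\<^sup>+\<tau>. indicator {1..2} \<tau> * ?G (\<tau> *\<^sub>R \<xi>) \<partial>lborel))"
      using v v0 by (simp add: mult.assoc[symmetric] ennreal_mult[symmetric])
    also have "\<dots> \<le> ennreal (2 / p) * ?J"
      using v v0 p by (intro mult_mono * ennreal_leI) (auto simp: field_simps)
    finally show ?thesis using True by simp
  qed
  \<comment> \<open>The interval [1, 2] has length 1, so integrating over it changes nothing.
    Rescaling \<xi> by \<tau> then costs at most 2 ^ d, and after exchanging the integrals the inner
    one is a ray integral bounded by \<open>inner\<close>, which vanishes outside a ball.\<close>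
  have "(\<integral>\<^sup>+\<xi>. F \<xi> \<partial>lborel) = (\<integral>\<^sup>+\<tau>. indicator {1..2::real} \<tau> * (\<integral>\<^sup>+\<xi>. ?G \<xi> \<partial>lborel) \<partial>lborel)"
    by (simp add: nn_integral_rot_avg nn_integral_multc)
  also have "\<dots> \<le> (\<integral>\<^sup>+\<tau>. indicator {1..2::real} \<tau> * (ennreal (2 ^ CARD('n)) * (\<integral>\<^sup>+\<xi>. ?G (\<tau> *\<^sub>R \<xi>) \<partial>lborel)) \<partial>lborel)"
  proof (intro nn_integral_mono)
    fix \<tau> :: real
    show "indicator {1..2} \<tau> * (\<integral>\<^sup>+\<xi>. ?G \<xi> \<partial>lborel) \<le> indicator {1..2} \<tau> * (ennreal (2 ^ CARD('n)) * (\<integral>\<^sup>+\<xi>. ?G (\<tau> *\<^sub>R \<xi>) \<partial>lborel))"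
    proof (cases "\<tau> \<in> {1..2}")
      case True
      have "(\<integral>\<^sup>+\<xi>. ?G \<xi> \<partial>lborel) = ennreal (\<tau> ^ CARD('n)) * (\<integral>\<^sup>+\<xi>. ?G (\<tau> *\<^sub>R \<xi>) \<partial>lborel)"
        using True by (subst nn_integral_scaleR[of _ \<tau>]) auto
      also have "\<dots> \<le> ennreal (2 ^ CARD('n)) * (\<integral>\<^sup>+\<xi>. ?G (\<tau> *\<^sub>R \<xi>) \<partial>lborel)"
        using True by (intro mult_right_mono ennreal_leI power_mono) auto
      finally show ?thesis by (intro mult_left_mono) auto
    qed simp
  qed
  also have "\<dots> = ennreal (2 ^ CARD('n)) * (\<integral>\<^sup>+\<tau>. (\<integral>\<^sup>+\<xi>. indicator {1..2::real} \<tau> * ?G (\<tau> *\<^sub>R \<xi>) \<partial>lborel) \<partial>lborel)"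
    by (simp add: nn_integral_cmult[symmetric] mult.left_commute)
  also have "\<dots> = ennreal (2 ^ CARD('n)) * (\<integral>\<^sup>+\<xi>. (\<integral>\<^sup>+\<tau>. indicator {1..2::real} \<tau> * ?G (\<tau> *\<^sub>R \<xi>) \<partial>lborel) \<partial>lborel)"
    by (subst lborel_pair.Fubini') auto
  also have "\<dots> \<le> ennreal (2 ^ CARD('n)) * (\<integral>\<^sup>+\<xi>. indicator (cball 0 (q * R)) (\<xi>::real^'n) * (ennreal (2 / p) * ?J) \<partial>lborel)"
    by (intro mult_left_mono nn_integral_mono inner) auto
  also have "\<dots> = ennreal (2 ^ CARD('n)) * (emeasure lborel (cball (0::real^'n) (q * R)) * (ennreal (2 / p) * ?J))"
    by (subst nn_integral_multc) (auto intro!: borel_measurable_indicator)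
  also have "\<dots> = ennreal (2 ^ CARD('n) * (2 / p)) * emeasure lborel (cball (0::real^'n) (q * R)) * ?J"
    using p by (subst ennreal_mult) (auto simp: mult_ac)
  finally show ?thesis by simp
qed

end

section \<open>Lower bounds for the spherical averages\<close>

lemma ennreal_div_le:
  assumes "ennreal x \<le> ennreal C * J" "0 < C" "0 \<le> x"
  shows "ennreal (x / C) \<le> J"
proof -
  have "ennreal (x / C) = ennreal (1 / C) * ennreal x"
    using assms by (simp add: ennreal_mult[symmetric])
  also have "\<dots> \<le> ennreal (1 / C) * (ennreal C * J)"
    using assms(1) by (rule mult_left_mono) simp
  also have "\<dots> = J"
    using assms(2) by (simp add: mult.assoc[symmetric] ennreal_mult[symmetric])
  finally show ?thesis .
qed

text \<open>Take the first index with t n \<le> t 0 / R. Its predecessor still exceeds t 0 / R, and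
  the ratio bound passes this on to t n up to the factor \<kappa>. The index 0 has no predecessor
  and is settled by \<kappa> R \<ge> 1.\<close>

lemma sequence_at_scale:
  fixes t :: "nat \<Rightarrow> real"
  assumes t_pos: "\<And>n. t n > 0" and t_lim: "t \<longlonglongrightarrow> 0"
    and t_ratio: "\<And>n. t n \<le> \<kappa> * t (Suc n)" and \<kappa>: "1 \<le> \<kappa>" and R: "1 \<le> R"
  obtains n where "t 0 / (\<kappa> * R) \<le> t n" "t n \<le> t 0 / R"
proof -
  have "0 < t 0 / R" using t_pos R by simp
  then have "\<exists>n. t n \<le> t 0 / R"
    using order_tendstoD(2)[OF t_lim, of "t 0 / R"] by (auto dest!: eventually_happens intro: less_imp_le)
  then have le: "t (LEAST n. t n \<le> t 0 / R) \<le> t 0 / R" (is "t ?n \<le> _") by (rule LeastI_ex)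
  have "t 0 / (\<kappa> * R) \<le> t ?n"
  proof (cases ?n)
    case 0
    have "t 0 / (\<kappa> * R) \<le> t 0 / 1"
      using \<kappa> R t_pos[of 0] mult_mono[OF \<kappa> R] by (intro divide_left_mono) auto
    then show ?thesis by (simp add: 0)
  next
    case (Suc m)
    then have "t 0 / R < t m" using not_less_Least[of m "\<lambda>n. t n \<le> t 0 / R"] by simp
    also have "\<dots> \<le> \<kappa> * t ?n" using t_ratio[of m] by (simp add: Suc)
    finally show ?thesis using \<kappa> R by (simp add: field_simps)
  qed
  with le that show thesis by blast
qed

text \<open>The constant is the maximum of v powr e * exp (- v^2 / 4), attained at v^2 = 2 e;
  accordingly ln y \<le> y - 1 is used at y = v^2 / (2 e), with equality at that point.\<close>

lemma powr_le_exp_sq: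
  fixes e v :: real
  assumes e: "0 < e" and v: "0 \<le> v"
  shows "v powr e \<le> exp (e / 2 * (ln (2 * e) - 1)) * exp (v\<^sup>2 / 4)"
proof (cases "v = 0")
  case False
  have "ln (v\<^sup>2 / (2 * e)) \<le> v\<^sup>2 / (2 * e) - 1"
    using False e by (intro ln_le_minus_one) auto
  then have "2 * ln v \<le> ln (2 * e) + (v\<^sup>2 / (2 * e) - 1)"
    using False e v by (simp add: ln_div ln_realpow)
  then have "e / 2 * (2 * ln v) \<le> e / 2 * (ln (2 * e) + (v\<^sup>2 / (2 * e) - 1))"
    using e by (intro mult_left_mono) auto
  also have "\<dots> = e / 2 * (ln (2 * e) - 1) + v\<^sup>2 / 4"
    using e by (simp add: field_simps)
  finally show ?thesis
    using False by (simp add: powr_def exp_add[symmetric] del: exp_le_cancel_iff) simp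
qed simp

context haar
begin

text \<open>The weight m (\<xi>) of the overview, as a rotation average integrated along the ray
  through \<xi>. The Jacobian power \<tau> ^ (2 d) of the dilations is left out; in the theorem it
  is bounded below by a ^ (2 d).\<close>

definition ray_energy :: "real \<Rightarrow> real \<Rightarrow> (real^'n \<Rightarrow> real) \<Rightarrow> real^'n \<Rightarrow> ennreal" where
  "ray_energy a b f \<xi> = 
     (\<integral>\<^sup>+\<tau>. indicator {a..b} \<tau> * rot_avg (\<lambda>\<eta>. ennreal ((cmod (fourier f \<eta>))\<^sup>2)) (\<tau> *\<^sub>R \<xi>) \<partial>lborel)"

lemma ray_energy_mono: "a' \<le> a \<Longrightarrow> b \<le> b' \<Longrightarrow> ray_energy a b f \<xi> \<le> ray_energy a' b' f \<xi>"
  unfolding ray_energy_def by (intro nn_integral_mono mult_right_mono) (auto simp: indicator_def)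

text \<open>The exponent is d + \<beta> because the annulus at radius R = norm \<xi> carries mass of
  order R powr (- \<beta>), and \<open>annulus_le_ray\<close> divides this by the volume of a ball
  of radius comparable to R.\<close>

lemma ray_energy_high:
  fixes f :: "real^'n \<Rightarrow> real" and \<beta> :: real
  assumes dim: "2 \<le> CARD('n)"
    and f: "integrable lborel f" and f2: "integrable lborel (\<lambda>x. (f x)\<^sup>2)"
    and \<beta>: "0 < \<beta>" "\<beta> < 2" and K: "0 < K" and hoelder: "\<And>u. sq_modulus f u \<le> K * norm u powr \<beta>"
    and \<kappa>2: "0 < \<kappa>2" and \<Theta>: "norm \<Theta> = 1"
    and t_pos: "\<And>n. t n > 0" and t_lim: "t \<longlonglongrightarrow> 0"
    and t_ratio: "\<And>n. t n \<le> \<kappa> * t (Suc n)" and \<kappa>: "1 \<le> \<kappa>"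
    and lower: "\<And>n. \<kappa>2 * t n powr \<beta> \<le> sq_modulus f (t n *\<^sub>R \<Theta>)"
  obtains a b c where "0 < a" "0 < c"
    "\<And>\<xi>. 1 \<le> norm \<xi> \<Longrightarrow> ennreal (c * norm \<xi> powr (- (CARD('n) + \<beta>))) \<le> ray_energy a b f \<xi>"
proof -
  have [measurable]: "f \<in> borel_measurable borel" using f by auto
  obtain A B c0 where AB: "0 < A" "0 < B" and c0: "0 < c0" and ann:
    "\<And>t h. 0 < t \<Longrightarrow> norm h = t \<Longrightarrow> \<kappa>2 * t powr \<beta> \<le> sq_modulus f h \<Longrightarrow>
       c0 * t powr \<beta> \<le> (\<integral>\<xi>. indicator {\<xi>. A \<le> t * norm \<xi> \<and> t * norm \<xi> \<le> B} \<xi> * (cmod (fourier f \<xi>))\<^sup>2 \<partial>lborel)"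
    using fourier_annulus_lower[OF f f2 \<beta> K hoelder \<kappa>2] by blast
  \<comment> \<open>The scale t n lies between t 0 / (\<kappa> R) and t 0 / R, so A \<le> t n * norm
    \<xi> \<le> B forces p R \<le> norm \<xi> \<le> q R, with p and q independent of R.\<close>
  define p where "p = A / t 0"
  define q where "q = B * \<kappa> / t 0"
  have pq: "0 < p" "0 < q" using AB t_pos[of 0] \<kappa> by (auto simp: p_def q_def)
  define V where "V = unit_ball_vol (real CARD('n))"
  have V: "0 < V" by (simp add: V_def)
  define D where "D = 2 ^ CARD('n) * 2 / p * (V * q ^ CARD('n))"
  have D: "0 < D" using pq V by (simp add: D_def)
  show thesis
  proof (rule that)
    show "0 < p / 2" using pq by simp
    show "0 < c0 * (t 0 / \<kappa>) powr \<beta> / D" using c0 t_pos[of 0] \<kappa> D by simp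
    fix \<xi>0 :: "real^'n" assume "1 \<le> norm \<xi>0"
    define R where "R = norm \<xi>0"
    have R: "1 \<le> R" using \<open>1 \<le> norm \<xi>0\<close> by (simp add: R_def)
    obtain n where n: "t 0 / (\<kappa> * R) \<le> t n" "t n \<le> t 0 / R"
      using sequence_at_scale[OF t_pos t_lim t_ratio \<kappa> R] .
    define F where "F \<xi> = indicator {\<xi>. p * R \<le> norm \<xi> \<and> norm \<xi> \<le> q * R} \<xi> * ennreal ((cmod (fourier f \<xi>))\<^sup>2)" for \<xi>
    have [measurable]: "F \<in> borel_measurable borel" unfolding F_def by measurable
    have Fle: "F \<xi> \<le> ennreal ((cmod (fourier f \<xi>))\<^sup>2)" for \<xi>
      by (auto simp: F_def indicator_def)
    have "c0 * ((t 0 / \<kappa>) powr \<beta> * R powr - \<beta>) = c0 * (t 0 / (\<kappa> * R)) powr \<beta>"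
      using t_pos[of 0] \<kappa> R by (simp add: powr_divide powr_mult powr_minus_divide)
    also have "\<dots> \<le> c0 * t n powr \<beta>"
      using n(1) c0 \<beta> t_pos[of 0] \<kappa> R by (intro mult_left_mono powr_mono2) auto
    also have "\<dots> \<le> (\<integral>\<xi>. indicator {\<xi>. A \<le> t n * norm \<xi> \<and> t n * norm \<xi> \<le> B} \<xi> * (cmod (fourier f \<xi>))\<^sup>2 \<partial>lborel)"
      using t_pos[of n] \<Theta> lower[of n] by (intro ann) auto
    finally have "ennreal (c0 * ((t 0 / \<kappa>) powr \<beta> * R powr - \<beta>)) \<le> 
        ennreal (\<integral>\<xi>. indicator {\<xi>. A \<le> t n * norm \<xi> \<and> t n * norm \<xi> \<le> B} \<xi> * (cmod (fourier f \<xi>))\<^sup>2 \<partial>lborel)"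
      by (rule ennreal_leI)
    also have "\<dots> = (\<integral>\<^sup>+\<xi>. ennreal (indicator {\<xi>. A \<le> t n * norm \<xi> \<and> t n * norm \<xi> \<le> B} \<xi> * (cmod (fourier f \<xi>))\<^sup>2) \<partial>lborel)"
      by (intro nn_integral_eq_integral[symmetric] integrable_fourier_annulus f f2 t_pos) auto
    also have "\<dots> \<le> (\<integral>\<^sup>+\<xi>. F \<xi> \<partial>lborel)"
    proof (rule nn_integral_mono)
      fix \<xi> :: "real^'n"
      show "ennreal (indicator {\<xi>. A \<le> t n * norm \<xi> \<and> t n * norm \<xi> \<le> B} \<xi> * (cmod (fourier f \<xi>))\<^sup>2) \<le> F \<xi>"
      proof (cases "A \<le> t n * norm \<xi> \<and> t n * norm \<xi> \<le> B")
        case True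
        have "A \<le> t 0 / R * norm \<xi>" using True mult_right_mono[OF n(2), of "norm \<xi>"] by simp
        moreover have "t 0 / (\<kappa> * R) * norm \<xi> \<le> B" using True mult_right_mono[OF n(1), of "norm \<xi>"] by simp
        ultimately have "p * R \<le> norm \<xi> \<and> norm \<xi> \<le> q * R"
          using t_pos[of 0] R \<kappa> by (simp add: p_def q_def field_simps)
        then show ?thesis by (simp add: F_def indicator_def)
      qed simp
    qed
    also have "\<dots> \<le> ennreal (2 ^ CARD('n) * 2 / p) * emeasure lborel (cball (0::real^'n) (q * R)) *
        (\<integral>\<^sup>+\<tau>. indicator {p/2..2*q} \<tau> * rot_avg F (\<tau> *\<^sub>R \<xi>0) \<partial>lborel)"
      using R pq by (intro annulus_le_ray[OF dim]) (auto simp: F_def R_def)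
    also have "emeasure lborel (cball (0::real^'n) (q * R)) = ennreal (V * (q * R) ^ CARD('n))"
      using pq R by (subst emeasure_cball) (auto simp: V_def)
    also have "ennreal (2 ^ CARD('n) * 2 / p) * ennreal (V * (q * R) ^ CARD('n)) = ennreal (D * R ^ CARD('n))"
      using pq R V by (subst ennreal_mult[symmetric]) (auto simp: D_def power_mult_distrib)
    also have "ennreal (D * R ^ CARD('n)) * (\<integral>\<^sup>+\<tau>. indicator {p/2..2*q} \<tau> * rot_avg F (\<tau> *\<^sub>R \<xi>0) \<partial>lborel) \<le>
        ennreal (D * R ^ CARD('n)) * ray_energy (p/2) (2*q) f \<xi>0"
      unfolding ray_energy_def rot_avg_def by (intro mult_left_mono nn_integral_mono Fle) auto
    finally have "ennreal (c0 * ((t 0 / \<kappa>) powr \<beta> * R powr - \<beta>) / (D * R ^ CARD('n))) \<le> ray_energy (p/2) (2*q) f \<xi>0"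
      using D R c0 by (intro ennreal_div_le) auto
    also have "c0 * ((t 0 / \<kappa>) powr \<beta> * R powr - \<beta>) / (D * R ^ CARD('n)) = 
       c0 * (t 0 / \<kappa>) powr \<beta> / D * R powr (- (CARD('n) + \<beta>))"
    proof -
      have "- (CARD('n) + \<beta>) = - \<beta> - real CARD('n)" by simp
      then have "R powr (- (CARD('n) + \<beta>)) = R powr - \<beta> / R ^ CARD('n)"
        using R by (simp only: powr_diff) (simp add: powr_realpow)
      then show ?thesis by simp
    qed
    finally show "ennreal (c0 * (t 0 / \<kappa>) powr \<beta> / D * norm \<xi>0 powr (- (CARD('n) + \<beta>))) \<le> ray_energy (p/2) (2*q) f \<xi>0"
      by (simp add: R_def)
  qed
qed

text \<open>If norm \<eta> * L \<le> 1, then \<eta> \<bullet> x has modulus at most 1 for all x in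
  S, so its cosine is at least 1/2 and the real part of the transform at least half the measure of
  S. The interval of dilations has length 1 / (2 L), which gives the 8.\<close>

lemma ray_energy_low:
  fixes S :: "(real^'n) set"
  assumes S: "S \<in> sets borel" "S \<subseteq> cball 0 L" and L: "0 < L" and pos: "0 < measure lborel S"
    and \<xi>: "norm \<xi> \<le> 1"
  shows "ennreal ((measure lborel S)\<^sup>2 / (8 * L)) \<le> ray_energy (1 / (2 * L)) (1 / L) (indicat_real S) \<xi>"
proof -
  let ?m = "measure lborel S"
  have fin: "emeasure lborel S < \<infinity>"
    using pos by (metis emeasure_eq_ennreal_measure ennreal_less_top infinity_ennreal_def measure_zero_top
        less_irrefl top.not_eq_extremum)
  have int: "integrable lborel (indicat_real S)"
    using S fin by simp
  have low: "(?m / 2)\<^sup>2 \<le> (cmod (fourier (indicat_real S) \<eta>))\<^sup>2" if \<eta>: "norm \<eta> * L \<le> 1" for \<eta>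
  proof -
    have "?m / 2 = (\<integral>x. indicat_real S x * (1 / 2) \<partial>lborel)"
      using S by (simp add: measure_restrict_space)
    also have "\<dots> \<le> (\<integral>x. indicat_real S x * cos (\<eta> \<bullet> x) \<partial>lborel)"
    proof (rule integral_mono)
      show "integrable lborel (\<lambda>x. indicat_real S x * cos (\<eta> \<bullet> x))"
        by (rule integrable_mult_bounded[OF int]) auto
      show "integrable lborel (\<lambda>x. indicat_real S x * (1 / 2))" using int by simp
      fix x
      show "indicat_real S x * (1 / 2) \<le> indicat_real S x * cos (\<eta> \<bullet> x)"
      proof (cases "x \<in> S")
        case True
        have "\<bar>\<eta> \<bullet> x\<bar> \<le> norm \<eta> * norm x" by (rule Cauchy_Schwarz_ineq2)
        also have "\<dots> \<le> norm \<eta> * L" using True S(2) by (intro mult_left_mono) auto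
        finally have "(\<eta> \<bullet> x)\<^sup>2 \<le> 1" using \<eta> by (simp add: abs_square_le_1)
        then have "1 / 2 \<le> cos (\<eta> \<bullet> x)" using two_minus_two_cos_le[of "\<eta> \<bullet> x"] by simp
        then show ?thesis using True by simp
      qed simp
    qed
    also have "\<dots> = Re (fourier (indicat_real S) \<eta>)" by (simp add: fourier_cos_sin[OF int])
    also have "\<dots> \<le> cmod (fourier (indicat_real S) \<eta>)" by (rule complex_Re_le_cmod)
    finally show ?thesis using pos by (intro power_mono) auto
  qed
  have "ennreal (?m\<^sup>2 / (8 * L)) = (\<integral>\<^sup>+\<tau>. ennreal ((?m / 2)\<^sup>2) * indicator {1 / (2 * L)..1 / L} \<tau> \<partial>lborel)"
    using L by (simp add: nn_integral_cmult_indicator ennreal_mult[symmetric] power_divide field_simps)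
  also have "\<dots> \<le> ray_energy (1 / (2 * L)) (1 / L) (indicat_real S) \<xi>"
    unfolding ray_energy_def
  proof (rule nn_integral_mono)
    fix \<tau> :: real
    show "ennreal ((?m / 2)\<^sup>2) * indicator {1 / (2 * L)..1 / L} \<tau> \<le> 
      indicator {1 / (2 * L)..1 / L} \<tau> * rot_avg (\<lambda>\<eta>. ennreal ((cmod (fourier (indicat_real S) \<eta>))\<^sup>2)) (\<tau> *\<^sub>R \<xi>)"
    proof (cases "\<tau> \<in> {1 / (2 * L)..1 / L}")
      case True
      have "ennreal ((?m / 2)\<^sup>2) = (\<integral>\<^sup>+\<sigma>. ennreal ((?m / 2)\<^sup>2) \<partial>H)"
        by (simp add: emeasure_space_1)
      also have "\<dots> \<le> rot_avg (\<lambda>\<eta>. ennreal ((cmod (fourier (indicat_real S) \<eta>))\<^sup>2)) (\<tau> *\<^sub>R \<xi>)"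
        unfolding rot_avg_def
      proof (intro nn_integral_mono ennreal_leI low)
        fix \<sigma> assume "\<sigma> \<in> space H"
        then have "orthogonal_transformation ((*v) (transpose \<sigma>))"
          by (simp add: space_H SO_orthogonal SO_transpose orthogonal_transformation_matrix)
        then have "norm (transpose \<sigma> *v (\<tau> *\<^sub>R \<xi>)) * L = \<bar>\<tau>\<bar> * norm \<xi> * L" 
          by (simp add: orthogonal_transformation_norm)
        also have "\<dots> \<le> 1 / L * 1 * L"
          using True L \<xi> by (intro mult_mono) auto
        finally show "norm (transpose \<sigma> *v (\<tau> *\<^sub>R \<xi>)) * L \<le> 1" using L by simp
      qed
      finally show ?thesis using True by simp
    qed simp
  qed
  finally show ?thesis .
qed

text \<open>\<open>gauss_weight r\<close> is the product of two copies of
  \<open>gauss_weight (r / sqrt 2)\<close>. One copy stays as the weight for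
  \<open>discrepancy_energy\<close>; the other pays for the polynomial decay of the ray energy,
  since it keeps (r |\<xi>|) powr e bounded. For |\<xi>| \<le> 1 there is no decay to pay for, and r
  \<le> 1 suffices.\<close>

lemma ray_energy_gauss:
  fixes f :: "real^'n \<Rightarrow> real"
  assumes c: "0 < c" and e: "0 < e"
    and low: "\<And>\<xi>. norm \<xi> \<le> 1 \<Longrightarrow> ennreal c \<le> ray_energy a b f \<xi>"
    and high: "\<And>\<xi>. 1 \<le> norm \<xi> \<Longrightarrow> ennreal (c * norm \<xi> powr - e) \<le> ray_energy a b f \<xi>"
  obtains c' where "0 < c'" "\<And>r \<xi>. 0 < r \<Longrightarrow> r \<le> 1 \<Longrightarrow> 
     ennreal (c' * r powr e * gauss_weight r \<xi>) \<le> ennreal (gauss_weight (r / sqrt 2) \<xi>) * ray_energy a b f \<xi>"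
proof -
  define C where "C = exp (e / 2 * (ln (2 * e) - 1))"
  have C: "0 < C" by (simp add: C_def)
  define D where "D = max 1 C"
  have D: "1 \<le> D" "C \<le> D" by (auto simp: D_def)
  show thesis
  proof (rule that)
    show "0 < c / D" using c D by simp
    fix r :: real and \<xi> :: "real^'n" assume r: "0 < r" "r \<le> 1"
    have gg: "gauss_weight r \<xi> = gauss_weight (r / sqrt 2) \<xi> * gauss_weight (r / sqrt 2) \<xi>"
      unfolding gauss_weight_def exp_add[symmetric]
      by (rule arg_cong[where f = exp]) (simp add: power_mult_distrib power_divide)
    have "ennreal (c / D * r powr e * gauss_weight (r / sqrt 2) \<xi>) \<le> ray_energy a b f \<xi>"
    proof (cases "norm \<xi> \<le> 1")
      case True
      have "c / D * r powr e * gauss_weight (r / sqrt 2) \<xi> \<le> c * 1 * 1"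
        using c D r e by (intro mult_mono gauss_weight_le_1 powr_le1) (auto simp: field_simps)
      then show ?thesis using low[OF True] by (metis ennreal_leI mult.right_neutral order_trans)
    next
      case False
      have "(r * norm \<xi>) powr e * gauss_weight (r / sqrt 2) \<xi> \<le> C * exp ((r * norm \<xi>)\<^sup>2 / 4) * gauss_weight (r / sqrt 2) \<xi>"
        unfolding C_def using e r by (intro mult_right_mono powr_le_exp_sq) auto
      also have "\<dots> = C * (exp ((r * norm \<xi>)\<^sup>2 / 4) * gauss_weight (r / sqrt 2) \<xi>)" by simp
      also have "exp ((r * norm \<xi>)\<^sup>2 / 4) * gauss_weight (r / sqrt 2) \<xi> = 1"
        unfolding gauss_weight_def exp_add[symmetric] by (simp add: power_mult_distrib power_divide)
      finally have "(r * norm \<xi>) powr e * gauss_weight (r / sqrt 2) \<xi> \<le> D" using D by simp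
      then have "c / D * norm \<xi> powr - e * ((r * norm \<xi>) powr e * gauss_weight (r / sqrt 2) \<xi>) \<le> c / D * norm \<xi> powr - e * D"
        using c D by (intro mult_left_mono) auto
      moreover have "norm \<xi> powr - e * (r * norm \<xi>) powr e = r powr e"
      proof -
        have "0 < norm \<xi>" using False by linarith
        then show ?thesis using r by (simp add: powr_mult powr_minus)
      qed
      ultimately have "c / D * r powr e * gauss_weight (r / sqrt 2) \<xi> \<le> c * norm \<xi> powr - e"
        using D by (simp add: mult.assoc[symmetric]) (simp add: mult_ac)
      then show ?thesis using high[of \<xi>] False by (meson ennreal_leI order_trans linear)
    qed
    from mult_left_mono[OF this, of "ennreal (gauss_weight (r / sqrt 2) \<xi>)"]
    show "ennreal (c / D * r powr e * gauss_weight r \<xi>) \<le> ennreal (gauss_weight (r / sqrt 2) \<xi>) * ray_energy a b f \<xi>"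
      using c D by (simp add: gg ennreal_mult[symmetric] mult_ac)
  qed
qed

end

subsection \<open>The discrepancy as a convolution\<close>

lemma lborel_integral_reflect:
  fixes g :: "'a::euclidean_space \<Rightarrow> 'b::{banach, second_countable_topology}"
  assumes [measurable]: "g \<in> borel_measurable borel"
  shows "(\<integral>x. g (c - x) \<partial>lborel) = (\<integral>x. g x \<partial>lborel)"
    and "integrable lborel (\<lambda>x. g (c - x)) \<longleftrightarrow> integrable lborel g"
proof -
  have d: "distr lborel borel (\<lambda>x. c - x) = (lborel :: 'a measure)"
    by (subst (2) lborel_affine[of "-1" c]) (auto simp: density_1)
  show "(\<integral>x. g (c - x) \<partial>lborel) = (\<integral>x. g x \<partial>lborel)"
    by (subst (2) d[symmetric]) (simp add: integral_distr)
  show "integrable lborel (\<lambda>x. g (c - x)) \<longleftrightarrow> integrable lborel g"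
    by (subst (2) d[symmetric]) (simp add: integrable_distr_eq)
qed

lemma lborel_integral_scaleR:
  fixes g :: "'a::euclidean_space \<Rightarrow> 'b::{banach, second_countable_topology}"
  assumes [measurable]: "g \<in> borel_measurable borel" and c: "0 < c"
  shows "(\<integral>x. g x \<partial>lborel) = c ^ DIM('a) *\<^sub>R (\<integral>x. g (c *\<^sub>R x) \<partial>lborel)"
  by (subst lborel_affine[of c 0]) (use c in \<open>simp_all add: integral_density integral_distr\<close>)

text \<open>The transform of the signed measure \<nu> of the overview, with N =
  \<open>card P\<close>.\<close>

definition exp_sum_diff :: "'a::euclidean_space measure \<Rightarrow> 'a set \<Rightarrow> 'a \<Rightarrow> complex" where
  "exp_sum_diff M P \<xi> = (\<Sum>z\<in>P. iexp (\<xi> \<bullet> z)) - of_nat (card P) * (\<integral>y. iexp (\<xi> \<bullet> y) \<partial>M)"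

locale finite_borel_measure = finite_measure M
  for M :: "'a::euclidean_space measure" +
  assumes sets_M [measurable_cong]: "sets M = sets borel"
begin

lemma space_M [simp]: "space M = UNIV"
  using sets_eq_imp_space_eq[OF sets_M] by simp

lemma exp_sum_diff_measurable [measurable]: "exp_sum_diff M P \<in> borel_measurable borel"
  unfolding exp_sum_diff_def by measurable

context
  fixes W :: "'a set" and P :: "'a set"
  assumes W [measurable]: "W \<in> sets borel" and W_fin: "emeasure lborel W < \<infinity>" and P: "finite P"
begin

lemma integrable_W: "integrable lborel (indicat_real W)"
  using W_fin by simp

text \<open>As a function of x the discrepancy is a correlation of \<nu> with the indicator of W.
  Hence its transform is a product, with a complex conjugate because x enters through z - x.\<close>

lemma discrepancy_eq:
  "discrepancy M P ((+) x ` W) = (\<Sum>z\<in>P. indicat_real W (z - x)) - card P * (\<integral>y. indicat_real W (y - x) \<partial>M)"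
proof -
  have mem: "y \<in> (+) x ` W \<longleftrightarrow> y - x \<in> W" for y
    by (metis (no_types, lifting) add_diff_cancel_left' image_iff le_add_diff_inverse add.commute diff_add_cancel)
  have "real (card (P \<inter> (+) x ` W)) = (\<Sum>z\<in>P. indicat_real ((+) x ` W) z)"
    using P by (simp add: sum.inter_restrict indicator_def of_bool_def) 
       (simp add: sum.If_cases P Int_def)
  also have "\<dots> = (\<Sum>z\<in>P. indicat_real W (z - x))"
    by (intro sum.cong refl) (simp add: indicator_def mem)
  finally have 1: "real (card (P \<inter> (+) x ` W)) = (\<Sum>z\<in>P. indicat_real W (z - x))" .
  have "(+) x ` W = (\<lambda>y. y - x) -` W" using mem by auto
  then have "(+) x ` W \<in> sets M"
    using measurable_sets[of "\<lambda>y. y - x" borel borel W] by (simp add: sets_M)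
  then have "measure M ((+) x ` W) = (\<integral>y. indicat_real ((+) x ` W) y \<partial>M)"
    by simp
  also have "\<dots> = (\<integral>y. indicat_real W (y - x) \<partial>M)"
    by (intro Bochner_Integration.integral_cong refl) (simp add: indicator_def mem)
  finally show ?thesis
    by (simp add: discrepancy_def 1)
qed

lemma integrable_diff_prod:
  "integrable (M \<Otimes>\<^sub>M lborel) (\<lambda>(y, x). indicat_real W (y - x))"
proof -
  interpret Q: pair_sigma_finite M lborel ..
  show ?thesis
  proof (rule Q.Fubini_integrable)
    show "integrable M (\<lambda>y. \<integral>x. norm (case (y, x) of (y, x) \<Rightarrow> indicat_real W (y - x)) \<partial>lborel)"
      using lborel_integral_reflect(1)[of "indicat_real W"] by simp
    show "AE y in M. integrable lborel (\<lambda>x. case (y, x) of (y, x) \<Rightarrow> indicat_real W (y - x))"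
      using lborel_integral_reflect(2)[of "indicat_real W"] integrable_W by simp
  qed simp
qed

lemma integrable_conv: "integrable lborel (\<lambda>x. \<integral>y. indicat_real W (y - x) \<partial>M)"
proof -
  interpret Q: pair_sigma_finite M lborel ..
  show ?thesis using Q.integrable_snd[OF integrable_diff_prod] .
qed

lemma fourier_reflect:
  "(\<integral>x. indicat_real W (y - x) *\<^sub>R iexp (\<xi> \<bullet> x) \<partial>lborel) = iexp (\<xi> \<bullet> y) * cnj (fourier (indicat_real W) \<xi>)"
proof -
  have "(\<integral>x. indicat_real W (y - x) *\<^sub>R iexp (\<xi> \<bullet> x) \<partial>lborel) = 
      (\<integral>x. indicat_real W (y - x) *\<^sub>R iexp (\<xi> \<bullet> (y - (y - x))) \<partial>lborel)"
    by simp
  also have "\<dots> = (\<integral>u. indicat_real W u *\<^sub>R iexp (\<xi> \<bullet> (y - u)) \<partial>lborel)"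
    by (rule lborel_integral_reflect(1)) measurable
  also have "\<dots> = (\<integral>u. iexp (\<xi> \<bullet> y) * cnj (indicat_real W u *\<^sub>R iexp (\<xi> \<bullet> u)) \<partial>lborel)"
    by (intro Bochner_Integration.integral_cong refl)
      (simp add: inner_diff_right right_diff_distrib exp_diff exp_cnj exp_minus scaleR_conv_of_real field_simps)
  also have "\<dots> = iexp (\<xi> \<bullet> y) * (\<integral>u. cnj (indicat_real W u *\<^sub>R iexp (\<xi> \<bullet> u)) \<partial>lborel)"
    by (rule integral_mult_right_zero)
  also have "\<dots> = iexp (\<xi> \<bullet> y) * cnj (fourier (indicat_real W) \<xi>)"
    unfolding fourier_def by (simp only: Bochner_Integration.integral_cnj)
  finally show ?thesis .
qed

lemma integrable_discrepancy: "integrable lborel (\<lambda>x. discrepancy M P ((+) x ` W))"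
  unfolding discrepancy_eq
proof (intro Bochner_Integration.integrable_diff Bochner_Integration.integrable_sum integrable_mult_right integrable_conv)
  show "integrable lborel (\<lambda>x. indicat_real W (z - x))" for z
    using lborel_integral_reflect(2)[of "indicat_real W"] integrable_W by simp
qed

text \<open>The discrepancy is bounded by a constant depending on P, so its square is dominated by a
  multiple of its modulus.\<close>

lemma integrable_discrepancy_sq: "integrable lborel (\<lambda>x. (discrepancy M P ((+) x ` W))\<^sup>2)"
proof (rule Bochner_Integration.integrable_bound)
  let ?D = "\<lambda>x. discrepancy M P ((+) x ` W)"
  let ?C = "real (card P) + real (card P) * measure M UNIV"
  show "integrable lborel (\<lambda>x. ?C * ?D x)" by (intro integrable_mult_right integrable_discrepancy)
  show "(\<lambda>x. (?D x)\<^sup>2) \<in> borel_measurable lborel"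
    using integrable_discrepancy by (intro borel_measurable_power) auto
  have "\<bar>?D x\<bar> \<le> ?C" for x
  proof -
    have "\<bar>?D x\<bar> \<le> real (card (P \<inter> (+) x ` W)) + real (card P) * measure M ((+) x ` W)"
      unfolding discrepancy_def by (intro order_trans[OF abs_triangle_ineq4]) simp
    also have "\<dots> \<le> ?C"
      using P bounded_measure[of "(+) x ` W"] by (intro add_mono mult_left_mono) (auto intro: card_mono)
    finally show ?thesis .
  qed
  then have "\<bar>?D x\<bar> * \<bar>?D x\<bar> \<le> ?C * \<bar>?D x\<bar>" for x by (intro mult_right_mono) auto
  then have "(?D x)\<^sup>2 \<le> ?C * \<bar>?D x\<bar>" for x by (simp add: power2_eq_square)
  then show "AE x in lborel. norm ((?D x)\<^sup>2) \<le> norm (?C * ?D x)"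
    by (auto simp: abs_mult)
qed

lemma fourier_discrepancy:
  "fourier (\<lambda>x. discrepancy M P ((+) x ` W)) \<xi> = exp_sum_diff M P \<xi> * cnj (fourier (indicat_real W) \<xi>)"
proof -
  interpret Q: pair_sigma_finite M lborel ..
  have i1: "integrable lborel (\<lambda>x. indicat_real W (z - x) *\<^sub>R iexp (\<xi> \<bullet> x))" for z
    using lborel_integral_reflect(2)[of "indicat_real W"] integrable_W by (intro integrable_iexp_inner) simp
  note i2 = integrable_iexp_inner[OF integrable_conv, of \<xi>]
  have int: "integrable (M \<Otimes>\<^sub>M lborel) (\<lambda>(y, x). indicat_real W (y - x) *\<^sub>R iexp (\<xi> \<bullet> x))"
    by (rule Bochner_Integration.integrable_bound[OF integrable_diff_prod]) auto
  have "(\<integral>x. (\<integral>y. indicat_real W (y - x) \<partial>M) *\<^sub>R iexp (\<xi> \<bullet> x) \<partial>lborel) = 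
      (\<integral>x. (\<integral>y. indicat_real W (y - x) *\<^sub>R iexp (\<xi> \<bullet> x) \<partial>M) \<partial>lborel)"
    by (intro Bochner_Integration.integral_cong refl integral_scaleR_left[symmetric] integrable_const_bound[of _ 1]) auto
  also have "\<dots> = (\<integral>y. (\<integral>x. indicat_real W (y - x) *\<^sub>R iexp (\<xi> \<bullet> x) \<partial>lborel) \<partial>M)"
    by (rule Q.Fubini_integral[OF int])
  also have "\<dots> = (\<integral>y. iexp (\<xi> \<bullet> y) \<partial>M) * cnj (fourier (indicat_real W) \<xi>)"
    unfolding fourier_reflect by simp
  finally have conv: "(\<integral>x. (\<integral>y. indicat_real W (y - x) \<partial>M) *\<^sub>R iexp (\<xi> \<bullet> x) \<partial>lborel) = 
    (\<integral>y. iexp (\<xi> \<bullet> y) \<partial>M) * cnj (fourier (indicat_real W) \<xi>)" .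
  have "fourier (\<lambda>x. discrepancy M P ((+) x ` W)) \<xi> = 
     (\<integral>x. (\<Sum>z\<in>P. indicat_real W (z - x) *\<^sub>R iexp (\<xi> \<bullet> x)) - 
       of_nat (card P) * ((\<integral>y. indicat_real W (y - x) \<partial>M) *\<^sub>R iexp (\<xi> \<bullet> x)) \<partial>lborel)"
    unfolding fourier_def discrepancy_eq
    by (intro Bochner_Integration.integral_cong refl) 
       (simp add: scaleR_conv_of_real left_diff_distrib sum_distrib_right mult.assoc)
  also have "\<dots> = (\<Sum>z\<in>P. iexp (\<xi> \<bullet> z) * cnj (fourier (indicat_real W) \<xi>)) - 
       of_nat (card P) * ((\<integral>y. iexp (\<xi> \<bullet> y) \<partial>M) * cnj (fourier (indicat_real W) \<xi>))"
    using i1 i2 by (subst Bochner_Integration.integral_diff) (auto simp only: Bochner_Integration.integral_sum 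
       fourier_reflect conv integral_mult_right_zero intro!: Bochner_Integration.integrable_sum integrable_mult_right)
  also have "\<dots> = exp_sum_diff M P \<xi> * cnj (fourier (indicat_real W) \<xi>)"
    by (simp add: exp_sum_diff_def left_diff_distrib sum_distrib_right)
  finally show ?thesis .
qed

text \<open>The defect in \<open>gauss_plancherel\<close> enters with a negative sign and is
  discarded; what remains is the half of Plancherel's formula that a lower bound requires.\<close>

lemma discrepancy_energy:
  assumes s: "0 < s"
  shows "ennreal (1 / (2 * pi) ^ DIM('a)) * (\<integral>\<^sup>+\<xi>. ennreal (gauss_weight s \<xi> * (cmod (exp_sum_diff M P \<xi>))\<^sup>2 * 
            (cmod (fourier (indicat_real W) \<xi>))\<^sup>2) \<partial>lborel)
     \<le> (\<integral>\<^sup>+x. ennreal ((discrepancy M P ((+) x ` W))\<^sup>2) \<partial>lborel)"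
proof -
  let ?D = "\<lambda>x. discrepancy M P ((+) x ` W)"
  note pl = gauss_plancherel(1)[OF integrable_discrepancy integrable_discrepancy_sq s]
  have nn: "0 \<le> (\<integral>u. gauss_density s u * (\<integral>x. (?D x - ?D (x + u))\<^sup>2 \<partial>lborel) \<partial>lborel)"
    using gauss_density_nonneg[OF s] by (intro Bochner_Integration.integral_nonneg mult_nonneg_nonneg) auto
  have "(\<integral>\<^sup>+\<xi>. ennreal (gauss_weight s \<xi> * (cmod (exp_sum_diff M P \<xi>))\<^sup>2 * (cmod (fourier (indicat_real W) \<xi>))\<^sup>2) \<partial>lborel)
     = (\<integral>\<^sup>+\<xi>. ennreal (gauss_weight s \<xi> * (cmod (fourier ?D \<xi>))\<^sup>2) \<partial>lborel)"
    by (simp add: fourier_discrepancy norm_mult power_mult_distrib mult.assoc)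
  also have "\<dots> = ennreal (\<integral>\<xi>. gauss_weight s \<xi> * (cmod (fourier ?D \<xi>))\<^sup>2 \<partial>lborel)"
    using pl by (intro nn_integral_eq_integral) (auto simp: has_bochner_integral_iff)
  also have "\<dots> \<le> ennreal ((2 * pi) ^ DIM('a) * (\<integral>x. (?D x)\<^sup>2 \<partial>lborel))"
    unfolding has_bochner_integral_integral_eq[OF pl] using nn by (intro ennreal_leI mult_left_mono) auto
  also have "\<dots> = ennreal ((2 * pi) ^ DIM('a)) * (\<integral>\<^sup>+x. ennreal ((?D x)\<^sup>2) \<partial>lborel)"
    by (subst nn_integral_eq_integral[OF integrable_discrepancy_sq]) (auto simp: ennreal_mult)
  finally have "ennreal (1 / (2 * pi) ^ DIM('a)) * (\<integral>\<^sup>+\<xi>. ennreal (gauss_weight s \<xi> * (cmod (exp_sum_diff M P \<xi>))\<^sup>2 * 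
      (cmod (fourier (indicat_real W) \<xi>))\<^sup>2) \<partial>lborel) \<le>
     ennreal (1 / (2 * pi) ^ DIM('a)) * (ennreal ((2 * pi) ^ DIM('a)) * (\<integral>\<^sup>+x. ennreal ((?D x)\<^sup>2) \<partial>lborel))"
    by (rule mult_left_mono) simp
  also have "\<dots> = (\<integral>\<^sup>+x. ennreal ((?D x)\<^sup>2) \<partial>lborel)"
    by (simp add: mult.assoc[symmetric] ennreal_mult[symmetric] del: mult.assoc)
  finally show ?thesis .
qed

end

end

subsection \<open>Gaussian energy of the point set\<close>

text \<open>The function x \<mapsto> f (x + u) is the indicator of S moved by - u. This sign is why
  the theorem is proved with - \<Theta> in place of \<Theta>.\<close>

lemma sq_modulus_indicator:
  fixes S :: "'a::euclidean_space set"
  assumes [measurable]: "S \<in> sets borel"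
  shows "sq_modulus (indicat_real S) u = measure lborel (symdiff ((\<lambda>y. - u + y) ` S) S)"
proof -
  have mem: "x \<in> (\<lambda>y. - u + y) ` S \<longleftrightarrow> x + u \<in> S" for x
    by (auto simp: image_iff) (metis add_diff_cancel_right' diff_conv_add_uminus add.commute)
  then have "(\<lambda>y. - u + y) ` S = (\<lambda>x. x + u) -` S" by blast
  then have [measurable]: "(\<lambda>y. - u + y) ` S \<in> sets borel"
    using measurable_sets[of "\<lambda>x. x + u" borel borel S] by simp
  have D: "x \<in> symdiff ((\<lambda>y. - u + y) ` S) S \<longleftrightarrow> (x + u \<in> S) \<noteq> (x \<in> S)" for x
    unfolding symdiff_def Un_iff Diff_iff mem by blast
  have [measurable]: "symdiff ((\<lambda>y. - u + y) ` S) S \<in> sets borel"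
    unfolding symdiff_def by measurable
  have "sq_modulus (indicat_real S) u = (\<integral>x. indicat_real (symdiff ((\<lambda>y. - u + y) ` S) S) x \<partial>lborel)"
    unfolding sq_modulus_def
    by (intro Bochner_Integration.integral_cong refl) (simp only: indicator_def D, simp)
  also have "\<dots> = measure lborel (symdiff ((\<lambda>y. - u + y) ` S) S)"
    by simp
  finally show ?thesis .
qed

text \<open>The change of variables by \<tau> \<sigma> has Jacobian \<tau> ^ d, and its adjoint acts
  on the frequency.\<close>

lemma fourier_rot_dil:
  fixes S :: "(real^'n) set"
  assumes S [measurable]: "S \<in> sets borel" and \<sigma>: "\<sigma> \<in> SO" and \<tau>: "0 < \<tau>"
  defines "W \<equiv> (\<lambda>y. \<tau> *\<^sub>R (\<sigma> *v y)) ` S"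
  shows "W \<in> sets borel"
    and "fourier (indicat_real W) \<xi> = of_real (\<tau> ^ CARD('n)) * fourier (indicat_real S) (\<tau> *\<^sub>R (transpose \<sigma> *v \<xi>))"
proof -
  have inv: "\<sigma> *v (transpose \<sigma> *v x) = x" "transpose \<sigma> *v (\<sigma> *v x) = x" for x
    using SO_orthogonal[OF \<sigma>] by (simp_all add: matrix_vector_mul_assoc orthogonal_matrix_def)
  have mem: "\<tau> *\<^sub>R (\<sigma> *v y) \<in> W \<longleftrightarrow> y \<in> S" for y
  proof
    assume "\<tau> *\<^sub>R (\<sigma> *v y) \<in> W"
    then obtain z where "z \<in> S" "\<sigma> *v y = \<sigma> *v z" using \<tau> by (auto simp: W_def)
    then show "y \<in> S" using inv(2) by metis
  qed (auto simp: W_def)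
  have "W = (\<lambda>x. transpose \<sigma> *v ((1 / \<tau>) *\<^sub>R x)) -` S"
  proof (intro set_eqI)
    fix x
    have "\<tau> *\<^sub>R (\<sigma> *v (transpose \<sigma> *v ((1 / \<tau>) *\<^sub>R x))) = x" using \<tau> by (simp add: inv)
    then show "x \<in> W \<longleftrightarrow> x \<in> (\<lambda>x. transpose \<sigma> *v ((1 / \<tau>) *\<^sub>R x)) -` S"
      using mem[of "transpose \<sigma> *v ((1 / \<tau>) *\<^sub>R x)"] by simp
  qed
  then show W [measurable]: "W \<in> sets borel"
    using measurable_sets[of "\<lambda>x. transpose \<sigma> *v ((1 / \<tau>) *\<^sub>R x)" borel borel S] by simp
  let ?g = "\<lambda>x. indicat_real W (\<tau> *\<^sub>R x) *\<^sub>R iexp (\<xi> \<bullet> (\<tau> *\<^sub>R x))"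
  have "fourier (indicat_real W) \<xi> = \<tau> ^ CARD('n) *\<^sub>R (\<integral>x. ?g x \<partial>lborel)"
    unfolding fourier_def by (subst lborel_integral_scaleR[of _ \<tau>]) (use \<tau> in auto)
  also have "(\<integral>x. ?g x \<partial>lborel) = (\<integral>y. ?g (\<sigma> *v y) \<partial>lborel)"
    by (subst lborel_distr_orthogonal[OF SO_orthogonal[OF \<sigma>], symmetric]) (simp add: integral_distr)
  also have "\<dots> = fourier (indicat_real S) (\<tau> *\<^sub>R (transpose \<sigma> *v \<xi>))"
    unfolding fourier_def
    by (intro Bochner_Integration.integral_cong refl)
      (simp add: indicator_def mem transpose_matrix_vector dot_lmul_matrix)
  finally show "fourier (indicat_real W) \<xi> = of_real (\<tau> ^ CARD('n)) * fourier (indicat_real S) (\<tau> *\<^sub>R (transpose \<sigma> *v \<xi>))"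
    by (simp add: scaleR_conv_of_real)
qed

text \<open>Tonelli's theorem brings the frequency outside, so that the averages over \<sigma> and
  \<tau> act on the transform of f alone.\<close>

lemma (in haar) nn_integral_ray_energy:
  fixes f :: "real^'n \<Rightarrow> real" and \<Phi> :: "real^'n \<Rightarrow> ennreal"
  assumes [measurable]: "f \<in> borel_measurable borel" "\<Phi> \<in> borel_measurable borel"
  shows "(\<integral>\<^sup>+\<tau>. indicator {a..b} \<tau> * (\<integral>\<^sup>+\<sigma>. (\<integral>\<^sup>+\<xi>. \<Phi> \<xi> * 
           ennreal ((cmod (fourier f (\<tau> *\<^sub>R (transpose \<sigma> *v \<xi>))))\<^sup>2) \<partial>lborel) \<partial>H) \<partial>lborel)
     = (\<integral>\<^sup>+\<xi>. \<Phi> \<xi> * ray_energy a b f \<xi> \<partial>lborel)"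
proof -
  interpret P: pair_sigma_finite H lborel ..
  let ?F = "\<lambda>\<eta>. ennreal ((cmod (fourier f \<eta>))\<^sup>2)"
  have "(\<integral>\<^sup>+\<sigma>. (\<integral>\<^sup>+\<xi>. \<Phi> \<xi> * ?F (\<tau> *\<^sub>R (transpose \<sigma> *v \<xi>)) \<partial>lborel) \<partial>H) = 
        (\<integral>\<^sup>+\<xi>. \<Phi> \<xi> * rot_avg ?F (\<tau> *\<^sub>R \<xi>) \<partial>lborel)" for \<tau>
  proof -
    have "(\<integral>\<^sup>+\<sigma>. (\<integral>\<^sup>+\<xi>. \<Phi> \<xi> * ?F (\<tau> *\<^sub>R (transpose \<sigma> *v \<xi>)) \<partial>lborel) \<partial>H) = 
        (\<integral>\<^sup>+\<xi>. (\<integral>\<^sup>+\<sigma>. \<Phi> \<xi> * ?F (\<tau> *\<^sub>R (transpose \<sigma> *v \<xi>)) \<partial>H) \<partial>lborel)"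
      by (rule P.Fubini'[symmetric]) measurable
    also have "\<dots> = (\<integral>\<^sup>+\<xi>. \<Phi> \<xi> * rot_avg ?F (\<tau> *\<^sub>R \<xi>) \<partial>lborel)"
      by (intro nn_integral_cong, subst nn_integral_cmult) (auto simp: rot_avg_def matrix_vector_mult_scaleR)
    finally show ?thesis .
  qed
  then have "(\<integral>\<^sup>+\<tau>. indicator {a..b} \<tau> * (\<integral>\<^sup>+\<sigma>. (\<integral>\<^sup>+\<xi>. \<Phi> \<xi> * 
           ?F (\<tau> *\<^sub>R (transpose \<sigma> *v \<xi>)) \<partial>lborel) \<partial>H) \<partial>lborel) = 
     (\<integral>\<^sup>+\<tau>. indicator {a..b} \<tau> * (\<integral>\<^sup>+\<xi>. \<Phi> \<xi> * rot_avg ?F (\<tau> *\<^sub>R \<xi>) \<partial>lborel) \<partial>lborel)"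
    by simp
  also have "\<dots> = (\<integral>\<^sup>+\<tau>. (\<integral>\<^sup>+\<xi>. indicator {a..b} \<tau> * (\<Phi> \<xi> * rot_avg ?F (\<tau> *\<^sub>R \<xi>)) \<partial>lborel) \<partial>lborel)"
    by (intro nn_integral_cong, subst nn_integral_cmult) auto
  also have "\<dots> = (\<integral>\<^sup>+\<xi>. (\<integral>\<^sup>+\<tau>. indicator {a..b} \<tau> * (\<Phi> \<xi> * rot_avg ?F (\<tau> *\<^sub>R \<xi>)) \<partial>lborel) \<partial>lborel)"
    by (rule lborel_pair.Fubini') measurable
  also have "\<dots> = (\<integral>\<^sup>+\<xi>. \<Phi> \<xi> * ray_energy a b f \<xi> \<partial>lborel)"
    unfolding ray_energy_def
    by (intro nn_integral_cong, subst nn_integral_cmult[symmetric]) (auto simp: mult_ac)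
  finally show ?thesis .
qed

text \<open>Cutting the space into shells \<open>k r \<le> |y - z| < (k + 1) r\<close> bounds the Gaussian potential of \<open>M\<close> at \<open>z\<close>
  by \<open>c\<^sub>0 r\<^sup>\<alpha>\<close> times this series.\<close>

lemma summable_gauss_powr:
  assumes "0 < \<alpha>"
  shows "summable (\<lambda>k. exp (- (real k)\<^sup>2 / 2) * (real k + 1) powr \<alpha>)"
proof (rule summable_comparison_test')
  let ?C = "exp (\<alpha> / 2 * (ln (2 * \<alpha>) - 1))"
  have "norm (exp (-1/2::real)) < 1" by simp
  then show "summable (\<lambda>k. (?C * exp (5 / 4)) * exp (-1/2) ^ k)"
    by (intro summable_mult summable_geometric)
  fix k :: nat
  have "exp (- (real k)\<^sup>2 / 2) * (real k + 1) powr \<alpha> \<le> exp (- (real k)\<^sup>2 / 2) * (?C * exp ((real k + 1)\<^sup>2 / 4))"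
    using assms by (intro mult_left_mono powr_le_exp_sq) auto
  also have "\<dots> = ?C * exp (- (real k)\<^sup>2 / 2 + (real k + 1)\<^sup>2 / 4)"
    by (simp only: exp_add mult_ac)
  also have "\<dots> \<le> ?C * exp (5 / 4 + real k * (- 1/2))"
  proof (intro mult_left_mono iffD2[OF exp_le_cancel_iff])
    \<comment> \<open>The right side is the tangent at k = 2 of the concave quadratic on the left,
      which leads to a geometric series.\<close>
    have "0 \<le> (real k - 2)\<^sup>2" by simp
    then show "- (real k)\<^sup>2 / 2 + (real k + 1)\<^sup>2 / 4 \<le> 5 / 4 + real k * (- 1/2)"
      by (simp add: power2_diff power2_sum field_simps)
  qed simp
  also have "\<dots> = ?C * exp (5 / 4) * exp (-1/2) ^ k"
    by (simp only: exp_add exp_of_nat_mult mult.assoc)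
  finally show "norm (exp (- (real k)\<^sup>2 / 2) * (real k + 1) powr \<alpha>) \<le> ?C * exp (5 / 4) * exp (-1/2) ^ k"
    by simp
qed

lemma (in finite_borel_measure) gauss_potential_le:
  assumes growth: "\<And>x r. 0 < r \<Longrightarrow> emeasure M (ball x r) \<le> ennreal (c0 * r powr \<alpha>)"
    and c0: "0 < c0" and \<alpha>: "0 < \<alpha>"
  obtains C where "0 < C" "\<And>z r. 0 < r \<Longrightarrow> (\<integral>y. gauss_weight (1 / r) (z - y) \<partial>M) \<le> C * r powr \<alpha>"
proof -
  define S where "S = (\<Sum>k. exp (- (real k)\<^sup>2 / 2) * (real k + 1) powr \<alpha>)"
  note sm = summable_gauss_powr[OF \<alpha>]
  have single: "g k \<le> (\<Sum>k. g k)" for g :: "nat \<Rightarrow> ennreal" and k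
    using sum_le_suminf[of g "{k}"] by simp
  have S: "0 < S" unfolding S_def by (rule suminf_pos[OF sm]) simp
  show thesis
  proof (rule that)
    show "0 < c0 * S" using c0 S by simp
    fix z :: 'a and r :: real assume r: "0 < r"
    have "ennreal (\<integral>y. gauss_weight (1 / r) (z - y) \<partial>M) = (\<integral>\<^sup>+y. ennreal (gauss_weight (1 / r) (z - y)) \<partial>M)"
      by (intro nn_integral_eq_integral[symmetric] integrable_const_bound[of _ 1]) (auto simp: gauss_weight_le_1)
    also have "\<dots> \<le> (\<integral>\<^sup>+y. (\<Sum>k. ennreal (exp (- (real k)\<^sup>2 / 2)) * indicator (ball z ((real k + 1) * r)) y) \<partial>M)"
    proof (rule nn_integral_mono)
      fix y
      \<comment> \<open>The k-th term of the series alone dominates the Gaussian at y, which lies in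
        the k-th shell. The shell is enlarged to a ball because the growth condition concerns
        balls.\<close>
      define k where "k = nat \<lfloor>norm (z - y) / r\<rfloor>"
      have k: "real k \<le> norm (z - y) / r" "norm (z - y) / r < real k + 1"
        using r by (auto simp: k_def intro!: of_nat_floor)
      have "(real k)\<^sup>2 \<le> (1 / r * norm (z - y))\<^sup>2" using k(1) by (intro power_mono) auto
      then have "ennreal (gauss_weight (1 / r) (z - y)) \<le> ennreal (exp (- (real k)\<^sup>2 / 2))"
        unfolding gauss_weight_def by (intro ennreal_leI) simp
      also have "\<dots> = ennreal (exp (- (real k)\<^sup>2 / 2)) * indicator (ball z ((real k + 1) * r)) y"
        using k(2) r by (simp add: indicator_def dist_norm field_simps)
      also have "\<dots> \<le> (\<Sum>k. ennreal (exp (- (real k)\<^sup>2 / 2)) * indicator (ball z ((real k + 1) * r)) y)"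
        by (rule single)
      finally show "ennreal (gauss_weight (1 / r) (z - y)) \<le> (\<Sum>k. ennreal (exp (- (real k)\<^sup>2 / 2)) * indicator (ball z ((real k + 1) * r)) y)" .
    qed
    also have "\<dots> = (\<Sum>k. ennreal (exp (- (real k)\<^sup>2 / 2)) * emeasure M (ball z ((real k + 1) * r)))"
      by (subst nn_integral_suminf) (auto simp: nn_integral_cmult_indicator sets_M 
          intro!: borel_measurable_times_ennreal borel_measurable_indicator)
    also have "\<dots> \<le> (\<Sum>k. ennreal (c0 * r powr \<alpha> * (exp (- (real k)\<^sup>2 / 2) * (real k + 1) powr \<alpha>)))"
    proof (intro suminf_le)
      fix k :: nat
      have "ennreal (exp (- (real k)\<^sup>2 / 2)) * emeasure M (ball z ((real k + 1) * r)) \<le> 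
          ennreal (exp (- (real k)\<^sup>2 / 2)) * ennreal (c0 * ((real k + 1) * r) powr \<alpha>)"
        using r by (intro mult_left_mono growth) auto
      also have "\<dots> = ennreal (c0 * r powr \<alpha> * (exp (- (real k)\<^sup>2 / 2) * (real k + 1) powr \<alpha>))"
        using r c0 by (simp add: ennreal_mult[symmetric] powr_mult mult_ac)
      finally show "ennreal (exp (- (real k)\<^sup>2 / 2)) * emeasure M (ball z ((real k + 1) * r)) \<le> 
          ennreal (c0 * r powr \<alpha> * (exp (- (real k)\<^sup>2 / 2) * (real k + 1) powr \<alpha>))" .
    qed auto
    also have "\<dots> = ennreal (\<Sum>k. c0 * r powr \<alpha> * (exp (- (real k)\<^sup>2 / 2) * (real k + 1) powr \<alpha>))"
      using c0 by (intro suminf_ennreal2 summable_mult sm) auto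
    also have "\<dots> = ennreal (c0 * S * r powr \<alpha>)"
      by (subst suminf_mult[OF sm]) (simp add: S_def mult_ac)
    finally show "(\<integral>y. gauss_weight (1 / r) (z - y) \<partial>M) \<le> c0 * S * r powr \<alpha>"
      using c0 S by (simp add: ennreal_le_iff)
  qed
qed

lemma gauss_cos_integral':
  fixes x :: "'a::euclidean_space"
  assumes r: "0 < r"
  shows "has_bochner_integral lborel (\<lambda>\<xi>. gauss_weight r \<xi> * cos (\<xi> \<bullet> x))
           ((sqrt (2 * pi) / r) ^ DIM('a) * gauss_weight (1 / r) x)"
proof -
  have "(2 * pi) ^ DIM('a) / (sqrt (2 * pi) * r) ^ DIM('a) = (sqrt (2 * pi) / r) ^ DIM('a)"
    unfolding power_divide[symmetric]
    by (rule arg_cong[where f = "\<lambda>u. u ^ DIM('a)"]) (use r in \<open>simp add: field_simps\<close>)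
  then show ?thesis
    using gauss_cos_integral[OF r, of x] by (simp add: gauss_density_def) (metis times_divide_eq_left)
qed

text \<open>Expand the square and drop the squared transform of N M. Integration turns each
  remaining cosine into a Gaussian in space times (sqrt (2 pi) / r) ^ d. Up to this factor the
  double sum over the points is at least its diagonal N, and the mixed terms cost at most 2 N^2
  B.\<close>

lemma (in finite_borel_measure) exp_sum_diff_energy:
  fixes B r :: real
  assumes P: "finite P" and r: "0 < r"
    and pot: "\<And>z. (\<integral>y. gauss_weight (1 / r) (z - y) \<partial>M) \<le> B"
  shows "ennreal ((sqrt (2 * pi) / r) ^ DIM('a) * (real (card P) - 2 * (real (card P))\<^sup>2 * B))
     \<le> (\<integral>\<^sup>+\<xi>. ennreal (gauss_weight r \<xi> * (cmod (exp_sum_diff M P \<xi>))\<^sup>2) \<partial>lborel)"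
proof -
  let ?N = "real (card P)"
  define Q where "Q = (sqrt (2 * pi) / r) ^ DIM('a)"
  have Q: "0 < Q" using r by (simp add: Q_def)
  have gc: "has_bochner_integral lborel (\<lambda>\<xi>. gauss_weight r \<xi> * cos (\<xi> \<bullet> x)) (Q * gauss_weight (1 / r) x)" for x :: 'a
    unfolding Q_def by (rule gauss_cos_integral'[OF r])
  define X where "X \<xi> = (\<Sum>z\<in>P. \<Sum>z'\<in>P. gauss_weight r \<xi> * cos (\<xi> \<bullet> (z - z')))" for \<xi>
  define Y where "Y z \<xi> = gauss_weight r \<xi> * (\<integral>y. cos (\<xi> \<bullet> (z - y)) \<partial>M)" for z \<xi>
  interpret R: pair_sigma_finite M lborel ..
  have gw: "integrable lborel (gauss_weight r :: 'a \<Rightarrow> real)"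
    using gauss_weight_integral[OF r, where 'a = 'a] by (simp add: has_bochner_integral_iff)
  have iX: "has_bochner_integral lborel X (\<Sum>z\<in>P. \<Sum>z'\<in>P. Q * gauss_weight (1 / r) (z - z'))"
    unfolding X_def by (intro has_bochner_integral_sum gc)
  have iY: "integrable lborel (Y z)" and vY: "integral\<^sup>L lborel (Y z) \<le> Q * B" for z
  proof -
    have int: "integrable (M \<Otimes>\<^sub>M lborel) (\<lambda>(y, \<xi>). gauss_weight r \<xi> * cos (\<xi> \<bullet> (z - y)))"
    proof (rule R.Fubini_integrable)
      show "integrable M (\<lambda>y. \<integral>\<xi>. norm (case (y, \<xi>) of (y, \<xi>) \<Rightarrow> gauss_weight r \<xi> * cos (\<xi> \<bullet> (z - y))) \<partial>lborel)"
      proof (rule integrable_const_bound[of _ "integral\<^sup>L lborel (gauss_weight r :: 'a \<Rightarrow> real)"])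
        show "AE y in M. norm (\<integral>\<xi>. norm (case (y, \<xi>) of (y, \<xi>) \<Rightarrow> gauss_weight r \<xi> * cos (\<xi> \<bullet> (z - y))) \<partial>lborel)
           \<le> integral\<^sup>L lborel (gauss_weight r :: 'a \<Rightarrow> real)"
        proof (rule AE_I2)
          fix y
          have "(\<integral>\<xi>. \<bar>gauss_weight r \<xi> * cos (\<xi> \<bullet> (z - y))\<bar> \<partial>lborel) \<le> integral\<^sup>L lborel (gauss_weight r :: 'a \<Rightarrow> real)"
            by (rule integral_mono'[OF gw]) (auto simp: abs_mult mult_left_le)
          then show "norm (\<integral>\<xi>. norm (case (y, \<xi>) of (y, \<xi>) \<Rightarrow> gauss_weight r \<xi> * cos (\<xi> \<bullet> (z - y))) \<partial>lborel)
           \<le> integral\<^sup>L lborel (gauss_weight r :: 'a \<Rightarrow> real)" by simp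
        qed
      qed measurable
      show "AE y in M. integrable lborel (\<lambda>\<xi>. case (y, \<xi>) of (y, \<xi>) \<Rightarrow> gauss_weight r \<xi> * cos (\<xi> \<bullet> (z - y)))"
        using gc by (auto simp: has_bochner_integral_iff)
    qed measurable
    have Yeq: "Y z = (\<lambda>\<xi>. \<integral>y. gauss_weight r \<xi> * cos (\<xi> \<bullet> (z - y)) \<partial>M)"
      by (simp add: Y_def fun_eq_iff)
    show "integrable lborel (Y z)" unfolding Yeq by (rule R.integrable_snd[OF int])
    have "integral\<^sup>L lborel (Y z) = (\<integral>y. (\<integral>\<xi>. gauss_weight r \<xi> * cos (\<xi> \<bullet> (z - y)) \<partial>lborel) \<partial>M)"
      unfolding Yeq by (rule R.Fubini_integral[OF int])
    also have "\<dots> = Q * (\<integral>y. gauss_weight (1 / r) (z - y) \<partial>M)"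
      unfolding has_bochner_integral_integral_eq[OF gc] by simp
    also have "\<dots> \<le> Q * B" using pot Q by (intro mult_left_mono) auto
    finally show "integral\<^sup>L lborel (Y z) \<le> Q * B" .
  qed
  let ?h = "\<lambda>\<xi>. X \<xi> - 2 * ?N * (\<Sum>z\<in>P. Y z \<xi>)"
  have ih: "integrable lborel ?h"
    using iX iY by (intro Bochner_Integration.integrable_diff integrable_mult_right Bochner_Integration.integrable_sum)
      (auto simp: has_bochner_integral_iff)
  have le: "?h \<xi> \<le> gauss_weight r \<xi> * (cmod (exp_sum_diff M P \<xi>))\<^sup>2" for \<xi>
  proof -
    define ac as bc bs where "ac = (\<Sum>z\<in>P. cos (\<xi> \<bullet> z))" and "as = (\<Sum>z\<in>P. sin (\<xi> \<bullet> z))"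
      and "bc = (\<integral>y. cos (\<xi> \<bullet> y) \<partial>M)" and "bs = (\<integral>y. sin (\<xi> \<bullet> y) \<partial>M)"
    have ib: "integrable M (\<lambda>y. cos (\<xi> \<bullet> y))" "integrable M (\<lambda>y. sin (\<xi> \<bullet> y))" "integrable M (\<lambda>y. iexp (\<xi> \<bullet> y))"
      by (rule integrable_const_bound[of _ 1]; auto)+
    have "Re (exp_sum_diff M P \<xi>) = ac - ?N * bc" "Im (exp_sum_diff M P \<xi>) = as - ?N * bs"
      unfolding exp_sum_diff_def ac_def as_def bc_def bs_def
      using integral_Re[OF ib(3)] integral_Im[OF ib(3)] by (simp_all add: Re_exp Im_exp)
    then have "(cmod (exp_sum_diff M P \<xi>))\<^sup>2 = (ac - ?N * bc)\<^sup>2 + (as - ?N * bs)\<^sup>2"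
      by (simp add: cmod_power2)
    also have "\<dots> = (ac\<^sup>2 + as\<^sup>2) - 2 * ?N * (ac * bc + as * bs) + ((?N * bc)\<^sup>2 + (?N * bs)\<^sup>2)"
      by (simp add: power2_diff algebra_simps)
    also have "\<dots> \<ge> (ac\<^sup>2 + as\<^sup>2) - 2 * ?N * (ac * bc + as * bs)" by simp
    finally have "(ac\<^sup>2 + as\<^sup>2) - 2 * ?N * (ac * bc + as * bs) \<le> (cmod (exp_sum_diff M P \<xi>))\<^sup>2" .
    then have *: "gauss_weight r \<xi> * ((ac\<^sup>2 + as\<^sup>2) - 2 * ?N * (ac * bc + as * bs)) \<le> gauss_weight r \<xi> * (cmod (exp_sum_diff M P \<xi>))\<^sup>2"
      by (rule mult_left_mono) simp
    have "ac\<^sup>2 + as\<^sup>2 = (\<Sum>z\<in>P. \<Sum>z'\<in>P. cos (\<xi> \<bullet> (z - z')))"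
      unfolding ac_def as_def power2_eq_square sum_product sum.distrib[symmetric] inner_diff_right cos_diff ..
    then have "X \<xi> = gauss_weight r \<xi> * (ac\<^sup>2 + as\<^sup>2)"
      by (simp add: X_def sum_distrib_left)
    moreover have "(\<Sum>z\<in>P. Y z \<xi>) = gauss_weight r \<xi> * (ac * bc + as * bs)"
    proof -
      have "Y z \<xi> = gauss_weight r \<xi> * (cos (\<xi> \<bullet> z) * bc + sin (\<xi> \<bullet> z) * bs)" for z
        unfolding Y_def bc_def bs_def inner_diff_right cos_diff using ib by simp
      then show ?thesis
        by (simp add: ac_def as_def sum_distrib_right sum_distrib_left distrib_left sum.distrib)
    qed
    ultimately have "?h \<xi> = gauss_weight r \<xi> * ((ac\<^sup>2 + as\<^sup>2) - 2 * ?N * (ac * bc + as * bs))"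
      by (simp add: right_diff_distrib)
    with * show ?thesis by simp
  qed
  have "Q * (?N - 2 * ?N\<^sup>2 * B) = Q * ?N - 2 * ?N * (\<Sum>z\<in>P. Q * B)"
    by (simp add: power2_eq_square right_diff_distrib)
  also have "\<dots> \<le> integral\<^sup>L lborel X - 2 * ?N * (\<Sum>z\<in>P. integral\<^sup>L lborel (Y z))"
  proof (intro diff_mono mult_left_mono sum_mono vY)
    have "Q * ?N = (\<Sum>z\<in>P. Q * gauss_weight (1 / r) (z - z))"
      by (simp add: gauss_weight_def)
    also have "\<dots> \<le> (\<Sum>z\<in>P. \<Sum>z'\<in>P. Q * gauss_weight (1 / r) (z - z'))"
    proof (rule sum_mono)
      fix z assume "z \<in> P"
      then show "Q * gauss_weight (1 / r) (z - z) \<le> (\<Sum>z'\<in>P. Q * gauss_weight (1 / r) (z - z'))"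
        using P Q by (intro member_le_sum[of z P "\<lambda>z'. Q * gauss_weight (1 / r) (z - z')"]) auto
    qed
    finally show "Q * ?N \<le> integral\<^sup>L lborel X"
      by (simp only: has_bochner_integral_integral_eq[OF iX])
  qed simp
  also have "\<dots> = integral\<^sup>L lborel ?h"
    using iX iY by (simp add: has_bochner_integral_iff)
  \<comment> \<open>The minorant \<open>?h\<close> can be negative at some frequencies, so its
    positive part is taken before passing to extended nonnegative integrals.\<close>
  also have "\<dots> \<le> (\<integral>\<xi>. max 0 (?h \<xi>) \<partial>lborel)"
    using ih by (intro integral_mono) auto
  finally have "ennreal (Q * (?N - 2 * ?N\<^sup>2 * B)) \<le> ennreal (\<integral>\<xi>. max 0 (?h \<xi>) \<partial>lborel)"
    by (rule ennreal_leI)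
  also have "\<dots> = (\<integral>\<^sup>+\<xi>. ennreal (max 0 (?h \<xi>)) \<partial>lborel)"
    using ih by (intro nn_integral_eq_integral[symmetric]) auto
  also have "\<dots> \<le> (\<integral>\<^sup>+\<xi>. ennreal (gauss_weight r \<xi> * (cmod (exp_sum_diff M P \<xi>))\<^sup>2) \<partial>lborel)"
    using le by (intro nn_integral_mono ennreal_leI) simp
  finally show ?thesis by (simp add: Q_def)
qed

section \<open>The support of the measure and the proof of the theorem\<close>

lemma null_sets_compl_msupport:
  fixes M :: "'a::{metric_space, second_countable_topology} measure"
  assumes sets_M: "sets M = sets borel"
  shows "- msupport M \<in> null_sets M"
proof -
  define F where "F = {B. open B \<and> emeasure M B = 0}"
  have "- msupport M = \<Union>F"
  proof (intro set_eqI iffI)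
    fix x assume "x \<in> - msupport M"
    then obtain r where "0 < r" "emeasure M (ball x r) = 0"
      by (auto simp: msupport_def not_less)
    then show "x \<in> \<Union>F" by (intro UnionI[of "ball x r"]) (auto simp: F_def)
  next
    fix x assume "x \<in> \<Union>F"
    then obtain B where B: "open B" "emeasure M B = 0" "x \<in> B" by (auto simp: F_def)
    then obtain r where r: "0 < r" "ball x r \<subseteq> B" by (meson open_contains_ball)
    then have "emeasure M (ball x r) \<le> emeasure M B"
      using B by (intro emeasure_mono) (auto simp: sets_M)
    with B r show "x \<in> - msupport M" by (auto simp: msupport_def not_less)
  qed
  \<comment> \<open>There may be uncountably many open null sets; by Lindelof's theorem countably
    many of them have the same union.\<close>
  moreover obtain F' where F': "F' \<subseteq> F" "countable F'" "\<Union>F' = \<Union>F"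
    using Lindelof[of F] by (auto simp: F_def)
  moreover have "(\<Union>B\<in>F'. B) \<in> null_sets M"
    using F' by (intro null_sets_UN') (auto simp: F_def null_sets_def sets_M)
  ultimately show ?thesis by simp
qed

text \<open>The estimate is squared, and its right side is an extended nonnegative integral, so no
  finiteness has to be known before a root is taken. A point distribution is a finite set P with N =
  \<open>card P\<close>; the constants a, b, c are chosen before P.\<close>

theorem theorem2:
  fixes \<mu> :: "(real^'n) measure" and H :: "(real^'n^'n) measure"
    and \<Omega> :: "(real^'n) set" and \<alpha> c0 \<beta> \<kappa>1 \<kappa>2 \<kappa>3 :: real
    and \<Theta> :: "real^'n" and t :: "nat \<Rightarrow> real"
  assumes dim: "CARD('n) \<ge> 2"
    and mu_borel: "sets \<mu> = sets borel"
    and supp_bdd: "bounded (msupport \<mu>)"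
    and supp_one: "emeasure \<mu> (msupport \<mu>) = 1"
    and alpha: "0 < \<alpha>" "\<alpha> \<le> real CARD('n)" and c0: "c0 > 0"
    and ball_growth: "\<And>x r. r > 0 \<Longrightarrow> emeasure \<mu> (ball x r) \<le> ennreal (c0 * r powr \<alpha>)"
    and Omega_borel: "\<Omega> \<in> sets borel" and Omega_bdd: "bounded \<Omega>"
    and Omega_pos: "emeasure lborel \<Omega> > 0"
    and beta: "0 < \<beta>" "\<beta> \<le> 1" and k1: "\<kappa>1 > 0"
    and upper: "\<exists>\<delta>>0. \<forall>h::real^'n. norm h < \<delta> \<longrightarrow>
                  measure lborel (symdiff ((\<lambda>y. h + y) ` \<Omega>) \<Omega>) \<le> \<kappa>1 * norm h powr \<beta>"
    and k2: "\<kappa>2 > 0" and k3: "\<kappa>3 > 0"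
    and Theta: "norm \<Theta> = 1"
    and t_pos: "\<And>n. t n > 0" and t_dec: "decseq t" and t_lim: "t \<longlonglongrightarrow> 0"
    and t_ratio: "\<And>n. t n \<le> \<kappa>3 * t (Suc n)"
    and lower: "\<And>n. \<kappa>2 * t n powr \<beta> \<le>
                  measure lborel (symdiff ((\<lambda>y. t n *\<^sub>R \<Theta> + y) ` \<Omega>) \<Omega>)"
    and haar: "is_haar_SO H"
  shows "\<exists>a b c. 0 < a \<and> 0 < b \<and> 0 < c \<and>
           (\<forall>P::(real^'n) set. finite P \<longrightarrow>
              ennreal ((c * real (card P) powr (1/2 - \<beta> / (2 * \<alpha>)))\<^sup>2) \<le>
              (\<integral>\<^sup>+ \<tau>. indicator {a..b} \<tau> *
                 (\<integral>\<^sup>+ \<sigma>. (\<integral>\<^sup>+ x. ennreal ((discrepancy \<mu> P (rot_dil_trans x \<tau> \<sigma> \<Omega>))\<^sup>2) \<partial>lborel) \<partial>H)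
               \<partial>lborel))"
proof -
  interpret haar H by standard (rule haar)
  have space_mu: "space \<mu> = UNIV" using sets_eq_imp_space_eq[OF mu_borel] by simp
  \<comment> \<open>The hypothesis fixes the mass of the support only; its complement is null, so
    \<mu> has total mass 1.\<close>
  have "emeasure \<mu> (space \<mu>) = emeasure \<mu> (msupport \<mu> \<union> - msupport \<mu>)"
    by (simp add: space_mu)
  also have "\<dots> = emeasure \<mu> (msupport \<mu>)"
  proof (rule emeasure_Un_null_set)
    show null: "- msupport \<mu> \<in> null_sets \<mu>" by (rule null_sets_compl_msupport[OF mu_borel])
    then have "space \<mu> - (- msupport \<mu>) \<in> sets \<mu>" by (intro sets.Diff) auto
    then show "msupport \<mu> \<in> sets \<mu>" by (simp add: space_mu)
  qed
  finally have "emeasure \<mu> (space \<mu>) = 1" using supp_one by simp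
  then have "finite_measure \<mu>" by (intro finite_measureI) simp
  then interpret finite_borel_measure \<mu>
    by (intro finite_borel_measure.intro finite_borel_measure_axioms.intro mu_borel)

  let ?d = "CARD('n)"
  let ?f = "indicat_real \<Omega>"
  define m where "m = measure lborel \<Omega>"
  obtain L where L: "0 < L" "\<Omega> \<subseteq> cball 0 L"
    using bounded_subset_ballD[OF Omega_bdd, of 0] ball_subset_cball by blast
  have fin: "emeasure lborel \<Omega> < \<infinity>"
    by (rule emeasure_bounded_finite[OF Omega_bdd])
  then have m: "0 < m" using Omega_pos by (simp add: m_def emeasure_eq_ennreal_measure)
  have f: "integrable lborel ?f" using Omega_borel fin by simp
  have [measurable]: "\<Omega> \<in> sets borel" by (rule Omega_borel)
  have f_sq: "(\<lambda>x. (?f x)\<^sup>2) = ?f" by (auto simp: indicator_def)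
  have f2: "integrable lborel (\<lambda>x. (?f x)\<^sup>2)" unfolding f_sq by (rule f)

  obtain \<delta> where \<delta>: "0 < \<delta>" and up: "\<And>h::real^'n. norm h < \<delta> \<Longrightarrow> 
      measure lborel (symdiff ((\<lambda>y. h + y) ` \<Omega>) \<Omega>) \<le> \<kappa>1 * norm h powr \<beta>"
    using upper by blast
  \<comment> \<open>The hypothesis covers shifts shorter than \<delta>. For longer ones the trivial
    bound 2 m is used, and the second summand of K makes it a Hoelder bound.\<close>
  define K where "K = \<kappa>1 + 2 * m / \<delta> powr \<beta>"
  have K: "0 < K" using k1 m by (simp add: K_def add_pos_nonneg)
  have hoelder: "sq_modulus ?f u \<le> K * norm u powr \<beta>" for u
  proof (cases "norm u < \<delta>")
    case True
    then have "sq_modulus ?f u \<le> \<kappa>1 * norm u powr \<beta>"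
      using up[of "- u"] by (simp add: sq_modulus_indicator[OF Omega_borel] del: uminus_add_conv_diff)
    also have "\<dots> \<le> K * norm u powr \<beta>" using m by (intro mult_right_mono) (auto simp: K_def)
    finally show ?thesis .
  next
    case False
    have "0 \<le> autocorr ?f u" by (simp add: autocorr_def)
    then have "sq_modulus ?f u \<le> 2 * m"
      using autocorr_eq(2)[OF f2, of u] by (simp add: sq_modulus_def f_sq m_def)
    also have "\<dots> = 2 * m / \<delta> powr \<beta> * \<delta> powr \<beta>" using \<delta> by simp
    also have "\<dots> \<le> K * norm u powr \<beta>"
      using False k1 m \<delta> beta by (intro mult_mono powr_mono2) (auto simp: K_def)
    finally show ?thesis .
  qed
  have low: "\<kappa>2 * t n powr \<beta> \<le> sq_modulus ?f (t n *\<^sub>R (- \<Theta>))" for n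
    using lower[of n] by (simp add: sq_modulus_indicator[OF Omega_borel] del: uminus_add_conv_diff)
  have ratio: "t n \<le> max 1 \<kappa>3 * t (Suc n)" for n
    using t_ratio[of n] mult_right_mono[of \<kappa>3 "max 1 \<kappa>3" "t (Suc n)"] t_pos[of "Suc n"] by linarith
  have side: "\<beta> < 2" "norm (- \<Theta>) = 1" "1 \<le> max 1 \<kappa>3" using beta Theta by auto
  obtain a1 b1 c1 where a1: "0 < a1" and c1: "0 < c1" and
    high1: "\<And>\<xi>. 1 \<le> norm \<xi> \<Longrightarrow> ennreal (c1 * norm \<xi> powr (- (?d + \<beta>))) \<le> ray_energy a1 b1 ?f \<xi>"
  proof (rule ray_energy_high[of ?f \<beta> K \<kappa>2 "- \<Theta>" t "max 1 \<kappa>3"])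
    show "sq_modulus ?f u \<le> K * norm u powr \<beta>" for u by (rule hoelder)
    show "t n \<le> max 1 \<kappa>3 * t (Suc n)" for n by (rule ratio)
    show "\<kappa>2 * t n powr \<beta> \<le> sq_modulus ?f (t n *\<^sub>R - \<Theta>)" for n by (rule low)
    fix a1 b1 c1 :: real
    assume "0 < a1" "0 < c1" and
      "\<And>\<xi>::real^'n. 1 \<le> norm \<xi> \<Longrightarrow> ennreal (c1 * norm \<xi> powr (- (?d + \<beta>))) \<le> ray_energy a1 b1 ?f \<xi>"
    then show thesis by (rule that)
  qed (rule dim f f2 beta(1) side K k2 t_pos t_lim)+
  \<comment> \<open>The interval [a, b] contains both the dilations for high frequencies and those
    for low ones.\<close>
  define a where "a = min a1 (1 / (2 * L))"
  define b where "b = max b1 (1 / L)"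
  define c2 where "c2 = min c1 (m\<^sup>2 / (8 * L))"
  have ab: "0 < a" "0 < b" and c2: "0 < c2" 
    using a1 L c1 m by (auto simp: a_def b_def c2_def less_max_iff_disj)
  have e: "0 < ?d + \<beta>" using beta by simp
  have "ennreal c2 \<le> ray_energy a b ?f \<xi>" if "norm \<xi> \<le> 1" for \<xi>
  proof -
    have "ennreal c2 \<le> ennreal (m\<^sup>2 / (8 * L))" by (intro ennreal_leI) (simp add: c2_def)
    also have "\<dots> \<le> ray_energy (1 / (2 * L)) (1 / L) ?f \<xi>"
      using ray_energy_low[OF Omega_borel L(2,1) _ that] m by (simp add: m_def)
    also have "\<dots> \<le> ray_energy a b ?f \<xi>" by (rule ray_energy_mono) (auto simp: a_def b_def)
    finally show ?thesis .
  qed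
  moreover have "ennreal (c2 * norm \<xi> powr - (?d + \<beta>)) \<le> ray_energy a b ?f \<xi>" if "1 \<le> norm \<xi>" for \<xi>
  proof -
    have "ennreal (c2 * norm \<xi> powr - (?d + \<beta>)) \<le> ennreal (c1 * norm \<xi> powr (- (?d + \<beta>)))"
      by (intro ennreal_leI mult_right_mono) (auto simp: c2_def)
    also have "\<dots> \<le> ray_energy a1 b1 ?f \<xi>" by (rule high1[OF that])
    also have "\<dots> \<le> ray_energy a b ?f \<xi>" by (rule ray_energy_mono) (auto simp: a_def b_def)
    finally show ?thesis .
  qed
  ultimately obtain c' where c': "0 < c'" and ray: "\<And>r \<xi>. 0 < r \<Longrightarrow> r \<le> 1 \<Longrightarrow> 
     ennreal (c' * r powr (?d + \<beta>) * gauss_weight r \<xi>) \<le> ennreal (gauss_weight (r / sqrt 2) \<xi>) * ray_energy a b ?f \<xi>"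
    using ray_energy_gauss[OF c2 e] by blast
  obtain C where C: "0 < C" and pot: "\<And>z r. 0 < r \<Longrightarrow> (\<integral>y. gauss_weight (1 / r) (z - y) \<partial>\<mu>) \<le> C * r powr \<alpha>"
    using gauss_potential_le[OF ball_growth c0 alpha(1)] by blast

  \<comment> \<open>With r = (\<epsilon> / N) powr (1 / \<alpha>) this makes C * r powr \<alpha> at
    most 1 / (4 N), so the mixed terms cost at most half of the diagonal N. The bound \<epsilon>
    \<le> 1 gives r \<le> 1.\<close>
  define \<epsilon> where "\<epsilon> = min 1 (1 / (4 * C))"
  have \<epsilon>: "0 < \<epsilon>" "\<epsilon> \<le> 1" "C * \<epsilon> \<le> 1 / 4"
    using C by (auto simp: \<epsilon>_def min_def field_simps)
  \<comment> \<open>The numerator is a lower bound for the squared Jacobian \<tau> ^ (2 d) on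
    [a, b]; the denominator comes from Plancherel's formula.\<close>
  define A where "A = a ^ (2 * ?d) / (2 * pi) ^ ?d"
  have A: "0 < A" using ab by (simp add: A_def)
  define C1 where "C1 = A * (c' * sqrt (2 * pi) ^ ?d * \<epsilon> powr (\<beta> / \<alpha>) / 2)"
  have C1: "0 < C1" using A c' \<epsilon> by (simp add: C1_def)
  show ?thesis
  proof (intro exI conjI allI impI)
    show "0 < a" "0 < b" by (fact ab)+
    show "0 < sqrt C1" using C1 by simp
    fix P :: "(real^'n) set" assume P: "finite P"
    let ?E = "\<integral>\<^sup>+ \<tau>. indicator {a..b} \<tau> *
                 (\<integral>\<^sup>+ \<sigma>. (\<integral>\<^sup>+ x. ennreal ((discrepancy \<mu> P (rot_dil_trans x \<tau> \<sigma> \<Omega>))\<^sup>2) \<partial>lborel) \<partial>H) \<partial>lborel"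
    show "ennreal ((sqrt C1 * real (card P) powr (1/2 - \<beta> / (2 * \<alpha>)))\<^sup>2) \<le> ?E"
    \<comment> \<open>For empty P the left side is 0 whatever the sign of the exponent, because 0
      powr x = 0.\<close>
    proof (cases "card P = 0")
      case False
      define N where "N = real (card P)"
      have N: "1 \<le> N" using False by (simp add: N_def)
      define r where "r = (\<epsilon> / N) powr (1 / \<alpha>)"
      have r: "0 < r" using \<epsilon> N by (simp add: r_def)
      have "\<epsilon> / N \<le> 1" using \<epsilon> N by (simp add: field_simps)
      then have r1: "r \<le> 1" unfolding r_def using \<epsilon> N alpha by (intro powr_le1) auto
      have r\<alpha>: "r powr \<alpha> = \<epsilon> / N" using \<epsilon> N alpha by (simp add: r_def powr_powr)
      have r\<beta>: "r powr \<beta> = \<epsilon> powr (\<beta> / \<alpha>) * N powr - (\<beta> / \<alpha>)"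
        using \<epsilon> N by (simp add: r_def powr_powr powr_divide powr_minus_divide)
      let ?\<nu> = "\<lambda>\<xi>. (cmod (exp_sum_diff \<mu> P \<xi>))\<^sup>2"
      define \<Phi> where "\<Phi> \<xi> = ennreal (A * (gauss_weight (r / sqrt 2) \<xi> * ?\<nu> \<xi>))" for \<xi>
      have [measurable]: "\<Phi> \<in> borel_measurable borel" unfolding \<Phi>_def by measurable
      have s: "0 < r / sqrt 2" using r by simp

      \<comment> \<open>Up to constants the target is N * r powr \<beta>. The power r powr \<beta>
        arises from the r powr (d + \<beta>) of the ray bound and the factor 1 / r ^ d of the
        Gaussian energy.\<close>
      have "(sqrt C1 * N powr (1/2 - \<beta> / (2 * \<alpha>)))\<^sup>2 = C1 * (N * N powr - (\<beta> / \<alpha>))"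
      proof -
        have "(N powr (1/2 - \<beta> / (2 * \<alpha>)))\<^sup>2 = N powr ((1/2 - \<beta> / (2 * \<alpha>)) + (1/2 - \<beta> / (2 * \<alpha>)))"
          by (simp only: power2_eq_square powr_add)
        also have "(1/2 - \<beta> / (2 * \<alpha>)) + (1/2 - \<beta> / (2 * \<alpha>)) = 1 + - (\<beta> / \<alpha>)" by (simp add: field_simps)
        also have "N powr (1 + - (\<beta> / \<alpha>)) = N * N powr - (\<beta> / \<alpha>)" using N by (simp only: powr_add) simp
        finally show ?thesis using C1 by (simp add: power_mult_distrib)
      qed
      also have "\<dots> = A * (c' * (sqrt (2 * pi) ^ ?d * r powr \<beta> * (N / 2)))"
        by (simp add: C1_def r\<beta>)
      also have "\<dots> \<le> A * (c' * (sqrt (2 * pi) ^ ?d * r powr \<beta> * (N - 2 * N\<^sup>2 * (C * r powr \<alpha>))))"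
      proof (intro mult_left_mono)
        have "2 * N\<^sup>2 * (C * r powr \<alpha>) = 2 * (C * \<epsilon>) * N"
          using N by (simp add: r\<alpha> power2_eq_square)
        also have "\<dots> \<le> 2 * (1 / 4) * N" using \<epsilon> N by (intro mult_right_mono mult_left_mono) auto
        finally show "N / 2 \<le> N - 2 * N\<^sup>2 * (C * r powr \<alpha>)" by simp
      qed (use A c' in auto)
      also have "\<dots> = A * (c' * r powr (?d + \<beta>)) * ((sqrt (2 * pi) / r) ^ ?d * (N - 2 * N\<^sup>2 * (C * r powr \<alpha>)))"
        using r by (simp add: powr_add powr_realpow power_divide)
      finally have "ennreal ((sqrt C1 * N powr (1/2 - \<beta> / (2 * \<alpha>)))\<^sup>2) \<le> 
          ennreal (A * (c' * r powr (?d + \<beta>)) * ((sqrt (2 * pi) / r) ^ ?d * (N - 2 * N\<^sup>2 * (C * r powr \<alpha>))))"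
        by (rule ennreal_leI)
      also have "\<dots> = ennreal (A * (c' * r powr (?d + \<beta>))) * ennreal ((sqrt (2 * pi) / r) ^ ?d * (N - 2 * N\<^sup>2 * (C * r powr \<alpha>)))"
        using A c' by (intro ennreal_mult') auto
      also have "\<dots> \<le> ennreal (A * (c' * r powr (?d + \<beta>))) * (\<integral>\<^sup>+\<xi>. ennreal (gauss_weight r \<xi> * ?\<nu> \<xi>) \<partial>lborel)"
        using exp_sum_diff_energy[OF P r pot[OF r]] by (intro mult_left_mono) (auto simp: N_def)
      also have "\<dots> = (\<integral>\<^sup>+\<xi>. ennreal (A * (c' * r powr (?d + \<beta>))) * ennreal (gauss_weight r \<xi> * ?\<nu> \<xi>) \<partial>lborel)"
        by (rule nn_integral_cmult[symmetric]) measurable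
      also have "\<dots> \<le> (\<integral>\<^sup>+\<xi>. \<Phi> \<xi> * ray_energy a b ?f \<xi> \<partial>lborel)"
      proof (rule nn_integral_mono)
        fix \<xi> :: "real^'n"
        have "ennreal (A * (c' * r powr (?d + \<beta>))) * ennreal (gauss_weight r \<xi> * ?\<nu> \<xi>) = 
            ennreal (A * ?\<nu> \<xi>) * ennreal (c' * r powr (?d + \<beta>) * gauss_weight r \<xi>)"
          using A c' by (simp add: ennreal_mult[symmetric] mult_ac)
        also have "\<dots> \<le> ennreal (A * ?\<nu> \<xi>) * (ennreal (gauss_weight (r / sqrt 2) \<xi>) * ray_energy a b ?f \<xi>)"
          by (intro mult_left_mono ray[OF r r1]) auto
        also have "\<dots> = \<Phi> \<xi> * ray_energy a b ?f \<xi>"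
          using A unfolding \<Phi>_def mult.assoc[symmetric] by (subst ennreal_mult[symmetric]) (auto simp: mult_ac)
        finally show "ennreal (A * (c' * r powr (?d + \<beta>))) * ennreal (gauss_weight r \<xi> * ?\<nu> \<xi>) \<le> \<Phi> \<xi> * ray_energy a b ?f \<xi>" .
      qed
      also have "\<dots> = (\<integral>\<^sup>+\<tau>. indicator {a..b} \<tau> * (\<integral>\<^sup>+\<sigma>. (\<integral>\<^sup>+\<xi>. \<Phi> \<xi> * 
           ennreal ((cmod (fourier ?f (\<tau> *\<^sub>R (transpose \<sigma> *v \<xi>))))\<^sup>2) \<partial>lborel) \<partial>H) \<partial>lborel)"
        by (rule nn_integral_ray_energy[symmetric]) measurable
      \<comment> \<open>The comparison is pointwise in \<tau> and \<sigma> and uses only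
        monotonicity of \<open>nn_integral\<close>, so measurability of the discrepancy energy in
        these two variables does not have to be established.\<close>
      also have "\<dots> \<le> ?E"
      proof (rule nn_integral_mono)
        fix \<tau> :: real
        show "indicator {a..b} \<tau> * (\<integral>\<^sup>+\<sigma>. (\<integral>\<^sup>+\<xi>. \<Phi> \<xi> * 
            ennreal ((cmod (fourier ?f (\<tau> *\<^sub>R (transpose \<sigma> *v \<xi>))))\<^sup>2) \<partial>lborel) \<partial>H) \<le> 
          indicator {a..b} \<tau> * (\<integral>\<^sup>+ \<sigma>. (\<integral>\<^sup>+ x. ennreal ((discrepancy \<mu> P (rot_dil_trans x \<tau> \<sigma> \<Omega>))\<^sup>2) \<partial>lborel) \<partial>H)"
        proof (cases "\<tau> \<in> {a..b}")
          case True
          then have \<tau>: "0 < \<tau>" "a \<le> \<tau>" using ab by auto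
          have "(\<integral>\<^sup>+\<xi>. \<Phi> \<xi> * ennreal ((cmod (fourier ?f (\<tau> *\<^sub>R (transpose \<sigma> *v \<xi>))))\<^sup>2) \<partial>lborel) \<le> 
             (\<integral>\<^sup>+ x. ennreal ((discrepancy \<mu> P (rot_dil_trans x \<tau> \<sigma> \<Omega>))\<^sup>2) \<partial>lborel)" if "\<sigma> \<in> space H" for \<sigma>
          proof -
            have \<sigma>: "\<sigma> \<in> SO" using that by (simp add: space_H)
            define W where "W = (\<lambda>y. \<tau> *\<^sub>R (\<sigma> *v y)) ` \<Omega>"
            have W [measurable]: "W \<in> sets borel" and
              FW: "\<And>\<xi>. fourier (indicat_real W) \<xi> = of_real (\<tau> ^ ?d) * fourier ?f (\<tau> *\<^sub>R (transpose \<sigma> *v \<xi>))"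
              unfolding W_def by (rule fourier_rot_dil[OF Omega_borel \<sigma> \<tau>(1)])+
            have "bounded ((\<lambda>y. \<tau> *\<^sub>R y) ` ((*v) \<sigma> ` \<Omega>))"
              by (intro bounded_scaling bounded_linear_image[OF Omega_bdd]) (simp add: linear_linear)
            then have "bounded W" by (simp add: W_def image_image)
            then have W_fin: "emeasure lborel W < \<infinity>" by (rule emeasure_bounded_finite)
            have rdt: "rot_dil_trans x \<tau> \<sigma> \<Omega> = (+) x ` W" for x
              by (simp add: rot_dil_trans_def W_def image_image)
            have "(\<integral>\<^sup>+\<xi>. \<Phi> \<xi> * ennreal ((cmod (fourier ?f (\<tau> *\<^sub>R (transpose \<sigma> *v \<xi>))))\<^sup>2) \<partial>lborel) \<le>
              (\<integral>\<^sup>+\<xi>. ennreal (1 / (2 * pi) ^ ?d) * ennreal (gauss_weight (r / sqrt 2) \<xi> * ?\<nu> \<xi> * (cmod (fourier (indicat_real W) \<xi>))\<^sup>2) \<partial>lborel)"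
            proof (rule nn_integral_mono)
              fix \<xi> :: "real^'n"
              let ?u = "(cmod (fourier ?f (\<tau> *\<^sub>R (transpose \<sigma> *v \<xi>))))\<^sup>2"
              let ?g = "gauss_weight (r / sqrt 2) \<xi> * ?\<nu> \<xi>"
              have "a ^ (2 * ?d) \<le> \<tau> ^ (2 * ?d)" using \<tau> ab by (intro power_mono) auto
              then have "1 / (2 * pi) ^ ?d * ?g * ?u * a ^ (2 * ?d) \<le> 1 / (2 * pi) ^ ?d * ?g * ?u * \<tau> ^ (2 * ?d)"
                by (intro mult_left_mono) auto
              also have "\<dots> = 1 / (2 * pi) ^ ?d * (?g * (cmod (fourier (indicat_real W) \<xi>))\<^sup>2)"
                using \<tau> by (simp add: FW norm_mult norm_power power_mult_distrib mult_ac flip: power_mult)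
              finally have "A * ?g * ?u \<le> 1 / (2 * pi) ^ ?d * (?g * (cmod (fourier (indicat_real W) \<xi>))\<^sup>2)"
                by (simp add: A_def mult_ac)
              then have "ennreal (A * ?g * ?u) \<le> ennreal (1 / (2 * pi) ^ ?d * (?g * (cmod (fourier (indicat_real W) \<xi>))\<^sup>2))"
                by (rule ennreal_leI)
              then show "\<Phi> \<xi> * ennreal ?u \<le> ennreal (1 / (2 * pi) ^ ?d) * ennreal (?g * (cmod (fourier (indicat_real W) \<xi>))\<^sup>2)"
                using A by (simp add: \<Phi>_def ennreal_mult[symmetric])
            qed
            also have "\<dots> = ennreal (1 / (2 * pi) ^ ?d) * (\<integral>\<^sup>+\<xi>. ennreal (gauss_weight (r / sqrt 2) \<xi> * ?\<nu> \<xi> * (cmod (fourier (indicat_real W) \<xi>))\<^sup>2) \<partial>lborel)"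
              by (rule nn_integral_cmult) measurable
            also have "\<dots> \<le> (\<integral>\<^sup>+ x. ennreal ((discrepancy \<mu> P (rot_dil_trans x \<tau> \<sigma> \<Omega>))\<^sup>2) \<partial>lborel)"
              using discrepancy_energy[OF W W_fin P s] by (simp add: rdt)
            finally show ?thesis .
          qed
          then show ?thesis by (rule mult_left_mono[OF nn_integral_mono]) auto
        qed simp
      qed
      finally show ?thesis by (simp add: N_def)
    qed simp
  qed
qed

end
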